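(* Let $0<k<1$, $\mu_1,\mu_2\in\mathbb R$, $\xi>0$, and for a delay $\tau>0$ consider the system $$u_{tt}-u_{xx}=0\ \text{ in }Q^k,\qquad u(0,t)=0\ \text{ on }(0,\infty),$$ $$u_x(l_k(t),t)=-\mu_1u_t(l_k(t),t)-\mu_2u_t(l_k(t-\tau),t-\tau)\ \text{ on }(0,\infty),$$ $$u(x,0)=u^0,\ u_t(x,0)=u^1\ \text{ in }(0,1),\qquad u_t(l_k(t-\tau),t-\tau)=g_0(t-\tau)\ \text{ on }(0,\tau),$$ with energy $$E_2(t)=\frac12\int_0^{l_k(t)}\big[u_t^2(x,t)+u_x^2(x,t)\big]dx+\frac{\xi}{2}\int_0^1u_t^2\big(l_k(t-\tau\rho),t-\tau\rho\big)d\rho .$$ (1) Let $\frac{1-\sqrt{1-k^2}}{k}<\mu_1<\frac{1+\sqrt{1-k^2}}{k}$. If $|\mu_2|<\frac{-|k\mu_1-1|+\sqrt{1-k^2}}{k}$, then there is some $\tau>0$ (depending on $\mu_1,\mu_2,\xi$) for which the energy $E_2$ of the system is decreasing. (2) For any $\mu_1\in\mathbb R$, if $\mu_2\ge\frac{|k\mu_1-1|+\sqrt{1-k^2}}{k}$, then there is some $\tau>0$ (depending on $\mu_1,\mu_2,\xi$) for which the energy $E_2$ of the system is always increasing.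
   Context: For $0<k<1$, $l_k(t)=1+kt$ and $Q^k=\{(x,t)\in\mathbb R^2 : 0<x<l_k(t),\ t>0\}$. The data are $(u^0,u^1,g_0)\in H^1_L(0,1)\times L^2(0,1)\times L^2(-\tau,0)$, where $H^1_L(0,1)=\{u\in H^1(0,1) : u(0)=0\}$. For negative times $s\in(-\tau,0)$ the quantity $u_t(l_k(s),s)$ is prescribed to be $g_0(s)$. Solutions are weak solutions $u\in H^1_{loc}(Q^k)$ (distributions $\phi$ with $\psi\phi\in H^1(Q^k)$ for every $\psi\in C_0^\infty(\mathbb R^2)$): the wave equation holds in the sense of distributions, and the boundary and initial conditions hold almost everywhere when $u_x,u_t$ are computed from the representation of $u$ as a function of $t+x$ plus a function of $t-x$. The assertions about the energy are for every solution (all initial data). "Increasing" and "decreasing" are in the non-strict sense: $E_2(t)\ge E_2(s)$, respectively $E_2(t)\le E_2(s)$, for $t\ge s\ge0$. *)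

theory Defs
  imports "HOL-Analysis.Analysis"
begin

section \<open>Test functions and Sobolev spaces\<close>

definition partial_deriv :: "'a::euclidean_space \<Rightarrow> ('a \<Rightarrow> real) \<Rightarrow> 'a \<Rightarrow> real"
  where "partial_deriv b \<phi> = (\<lambda>p. frechet_derivative \<phi> (at p) b)"

primrec C_n :: "nat \<Rightarrow> ('a::euclidean_space \<Rightarrow> real) \<Rightarrow> bool" where
  "C_n 0 \<phi> \<longleftrightarrow> continuous_on UNIV \<phi>"
| "C_n (Suc n) \<phi> \<longleftrightarrow> (\<forall>p. \<phi> differentiable (at p)) \<and> (\<forall>b\<in>Basis. C_n n (partial_deriv b \<phi>))"

definition test_fun :: "'a::euclidean_space set \<Rightarrow> ('a \<Rightarrow> real) \<Rightarrow> bool"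
  where "test_fun \<Omega> \<phi> \<longleftrightarrow> (\<forall>n. C_n n \<phi>) \<and>
    compact (closure {p. \<phi> p \<noteq> 0}) \<and> closure {p. \<phi> p \<noteq> 0} \<subseteq> \<Omega>"

text \<open>Elements of Lebesgue and Sobolev spaces are given by Borel measurable representatives;
  values outside of \<open>\<Omega>\<close> are irrelevant.\<close>

definition L2 :: "'a::euclidean_space set \<Rightarrow> ('a \<Rightarrow> real) \<Rightarrow> bool"
  where "L2 \<Omega> w \<longleftrightarrow> set_borel_measurable lborel \<Omega> w \<and> set_integrable lborel \<Omega> (\<lambda>p. (w p)\<^sup>2)"

definition L2_loc :: "'a::euclidean_space set \<Rightarrow> ('a \<Rightarrow> real) \<Rightarrow> bool"
  where "L2_loc \<Omega> w \<longleftrightarrow> (\<forall>K. compact K \<and> K \<subseteq> \<Omega> \<longrightarrow> L2 K w)"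

definition weak_deriv ::
    "'a::euclidean_space set \<Rightarrow> 'a \<Rightarrow> ('a \<Rightarrow> real) \<Rightarrow> ('a \<Rightarrow> real) \<Rightarrow> bool"
  where "weak_deriv \<Omega> b w w' \<longleftrightarrow> (\<forall>\<phi>. test_fun \<Omega> \<phi> \<longrightarrow>
    (LINT p:\<Omega>|lborel. w p * partial_deriv b \<phi> p) = - (LINT p:\<Omega>|lborel. w' p * \<phi> p))"

definition H1 :: "'a::euclidean_space set \<Rightarrow> ('a \<Rightarrow> real) \<Rightarrow> bool"
  where "H1 \<Omega> w \<longleftrightarrow> L2 \<Omega> w \<and> (\<forall>b\<in>Basis. \<exists>w'. L2 \<Omega> w' \<and> weak_deriv \<Omega> b w w')"

text \<open>The cut-off functions are not required to vanish at the boundary of \<open>\<Omega>\<close>, so this is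
  regularity up to the boundary. A distribution with this property is a function.\<close>

definition H1_loc :: "'a::euclidean_space set \<Rightarrow> ('a \<Rightarrow> real) \<Rightarrow> bool"
  where "H1_loc \<Omega> w \<longleftrightarrow> (\<forall>\<psi>. test_fun UNIV \<psi> \<longrightarrow> H1 \<Omega> (\<lambda>p. \<psi> p * w p))"

text \<open>The value at \<open>0\<close> is that of the continuous representative on \<open>[0,1]\<close>.\<close>

definition H1_L :: "(real \<Rightarrow> real) \<Rightarrow> bool"
  where "H1_L w \<longleftrightarrow> H1 {0<..<1} w \<and> continuous_on {0..1} w \<and> w 0 = 0"

section \<open>The wave equation with delayed boundary feedback\<close>

definition l :: "real \<Rightarrow> real \<Rightarrow> real"
  where "l k t = 1 + k * t"

definition Q :: "real \<Rightarrow> (real \<times> real) set"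
  where "Q k = {(x, t). 0 < x \<and> x < l k t \<and> t > 0}"

definition wave_eq :: "(real \<times> real) set \<Rightarrow> (real \<times> real \<Rightarrow> real) \<Rightarrow> bool"
  where "wave_eq \<Omega> u \<longleftrightarrow> (\<forall>\<phi>. test_fun \<Omega> \<phi> \<longrightarrow>
    (LINT p:\<Omega>|lborel. u p * (partial_deriv (0, 1) (partial_deriv (0, 1) \<phi>) p
                         - partial_deriv (1, 0) (partial_deriv (1, 0) \<phi>) p)) = 0)"

text \<open>The representation \<open>u(x,t) = f(t + x) + g(t - x)\<close>, where \<open>f'\<close> and \<open>g'\<close> are the weak
  derivatives of \<open>f\<close> and \<open>g\<close>. On \<open>Q k\<close> the variables \<open>t + x\<close> and \<open>t - x\<close> range over
  \<open>(0,\<infinity>)\<close> and \<open>(-1,\<infinity>)\<close>. Every solution of the wave equation in \<open>H1_loc (Q k)\<close> has such a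
  representation; it is unique up to null sets and replacing \<open>f, g\<close> by \<open>f + c, g - c\<close>.\<close>

definition dAlembert_rep :: "real \<Rightarrow> (real \<times> real \<Rightarrow> real) \<Rightarrow>
    (real \<Rightarrow> real) \<Rightarrow> (real \<Rightarrow> real) \<Rightarrow> (real \<Rightarrow> real) \<Rightarrow> (real \<Rightarrow> real) \<Rightarrow> bool"
  where "dAlembert_rep k u f g f' g' \<longleftrightarrow>
    L2_loc {0<..} f \<and> L2_loc {0<..} f' \<and> weak_deriv {0<..} 1 f f' \<and>
    L2_loc {-1<..} g \<and> L2_loc {-1<..} g' \<and> weak_deriv {-1<..} 1 g g' \<and>
    (AE (x, t) in lborel. (x, t) \<in> Q k \<longrightarrow> u (x, t) = f (t + x) + g (t - x))"

definition u_t :: "(real \<Rightarrow> real) \<Rightarrow> (real \<Rightarrow> real) \<Rightarrow> real \<Rightarrow> real \<Rightarrow> real"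
  where "u_t f' g' x t = f' (t + x) + g' (t - x)"

definition u_x :: "(real \<Rightarrow> real) \<Rightarrow> (real \<Rightarrow> real) \<Rightarrow> real \<Rightarrow> real \<Rightarrow> real"
  where "u_x f' g' x t = f' (t + x) - g' (t - x)"

text \<open>The velocity \<open>u\<^sub>t(l\<^sub>k(s),s)\<close>, which for negative times is the prescribed history \<open>g0\<close>.\<close>

definition bdry_vel :: "real \<Rightarrow> (real \<Rightarrow> real) \<Rightarrow> (real \<Rightarrow> real) \<Rightarrow> (real \<Rightarrow> real) \<Rightarrow> real \<Rightarrow> real"
  where "bdry_vel k g0 f' g' s = (if s < 0 then g0 s else u_t f' g' (l k s) s)"

definition weak_solution ::
    "real \<Rightarrow> real \<Rightarrow> real \<Rightarrow> real \<Rightarrow> (real \<Rightarrow> real) \<Rightarrow> (real \<Rightarrow> real) \<Rightarrow> (real \<Rightarrow> real) \<Rightarrow>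
     (real \<times> real \<Rightarrow> real) \<Rightarrow>
     (real \<Rightarrow> real) \<Rightarrow> (real \<Rightarrow> real) \<Rightarrow> (real \<Rightarrow> real) \<Rightarrow> (real \<Rightarrow> real) \<Rightarrow> bool"
  where "weak_solution k \<mu>1 \<mu>2 \<tau> u0 u1 g0 u f g f' g' \<longleftrightarrow>
    H1_L u0 \<and> L2 {0<..<1} u1 \<and> L2 {-\<tau><..<0} g0 \<and>
    H1_loc (Q k) u \<and> wave_eq (Q k) u \<and> dAlembert_rep k u f g f' g' \<and>
    (AE t in lborel. t > 0 \<longrightarrow> f t + g t = 0) \<and>
    (AE t in lborel. t > 0 \<longrightarrow>
       u_x f' g' (l k t) t = - \<mu>1 * bdry_vel k g0 f' g' t - \<mu>2 * bdry_vel k g0 f' g' (t - \<tau>)) \<and>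
    (AE x in lborel. 0 < x \<and> x < 1 \<longrightarrow> f x + g (- x) = u0 x) \<and>
    (AE x in lborel. 0 < x \<and> x < 1 \<longrightarrow> u_t f' g' x 0 = u1 x)"

definition E2 :: "real \<Rightarrow> real \<Rightarrow> real \<Rightarrow> (real \<Rightarrow> real) \<Rightarrow> (real \<Rightarrow> real) \<Rightarrow> (real \<Rightarrow> real) \<Rightarrow>
    real \<Rightarrow> real"
  where "E2 k \<xi> \<tau> g0 f' g' t =
    1 / 2 * (LINT x:{0<..<l k t}|lborel. (u_t f' g' x t)\<^sup>2 + (u_x f' g' x t)\<^sup>2)
    + \<xi> / 2 * (LINT \<rho>:{0<..<1}|lborel. (bdry_vel k g0 f' g' (t - \<tau> * \<rho>))\<^sup>2)"

end

theory Submission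
  imports Defs "HOL-Computational_Algebra.Polynomial"
begin

text \<open>Write \<open>u = f(t + x) + g(t - x)\<close>. The condition at \<open>x = 0\<close> gives \<open>f' = -g'\<close>, so the increment of the
  energy is the integral over \<open>r\<close> of \<open>(1 + k) a\<^sup>2 - (1 - k) b\<^sup>2 + c (v\<^sup>2 - w\<^sup>2)\<close>, where \<open>a = f'(r + l r)\<close>,
  \<open>b = g'(r - l r)\<close>, \<open>v = a + b\<close> is the boundary velocity, \<open>w = v(r - \<tau>)\<close> and \<open>c = \<xi> / (2 \<tau>)\<close>. By the
  feedback law this is, up to the factor \<open>2 k\<close>, the quadratic form
  \<open>(p v + n w)\<^sup>2 - S\<^sup>2 v\<^sup>2 + C (v\<^sup>2 - w\<^sup>2)\<close> with \<open>p = k \<mu>1 - 1\<close>, \<open>n = k \<mu>2\<close>, \<open>S\<^sup>2 = 1 - k\<^sup>2\<close> and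
  \<open>C = k \<xi> / \<tau>\<close>, which is at our disposal: \<open>C = S (S - \<bar>p\<bar>)\<close> makes it negative semidefinite in the
  first case, \<open>C = S n\<close> positive semidefinite in the second.\<close>

section \<open>Smooth bump functions\<close>

lemma partial_deriv_real:
  assumes "(\<phi> has_real_derivative d) (at x)"
  shows "partial_deriv 1 \<phi> x = d"
  unfolding partial_deriv_def frechet_derivative_at[OF assms[unfolded has_field_derivative_def], symmetric]
  by simp

lemma has_real_derivative_partial_deriv:
  fixes \<phi> :: "real \<Rightarrow> real"
  assumes "\<phi> differentiable (at x)"
  shows "(\<phi> has_real_derivative partial_deriv 1 \<phi> x) (at x)"
  using assms partial_deriv_real real_differentiable_def by metis

text \<open>The only basis vector of the reals is 1, so \<open>C_n\<close> is a recursion along one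
  ordinary derivative. With the derivative existentially quantified, the closure rules below only
  have to exhibit it and apply the induction hypothesis.\<close>

lemma C_n_Suc_real_iff:
  fixes \<phi> :: "real \<Rightarrow> real"
  shows "C_n (Suc n) \<phi> \<longleftrightarrow> (\<exists>\<phi>'. (\<forall>x. (\<phi> has_real_derivative \<phi>' x) (at x)) \<and> C_n n \<phi>')"
proof
  assume "C_n (Suc n) \<phi>"
  then show "\<exists>\<phi>'. (\<forall>x. (\<phi> has_real_derivative \<phi>' x) (at x)) \<and> C_n n \<phi>'"
    using has_real_derivative_partial_deriv by auto
next
  assume "\<exists>\<phi>'. (\<forall>x. (\<phi> has_real_derivative \<phi>' x) (at x)) \<and> C_n n \<phi>'"
  then obtain \<phi>' where *: "\<And>x. (\<phi> has_real_derivative \<phi>' x) (at x)" "C_n n \<phi>'" by blast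
  then have "partial_deriv 1 \<phi> = \<phi>'" using partial_deriv_real by blast
  then show "C_n (Suc n) \<phi>" using * real_differentiable_def by auto
qed

lemma C_n_SucD:
  fixes \<phi> :: "real \<Rightarrow> real"
  shows "C_n (Suc n) \<phi> \<Longrightarrow> C_n n \<phi>"
proof (induction n arbitrary: \<phi>)
  case 0
  then show ?case
    by (auto simp: continuous_on_eq_continuous_at intro!: differentiable_imp_continuous_within)
next
  case (Suc n)
  then show ?case by (metis C_n_Suc_real_iff)
qed

lemma C_n_add:
  fixes \<phi> \<psi> :: "real \<Rightarrow> real"
  shows "C_n n \<phi> \<Longrightarrow> C_n n \<psi> \<Longrightarrow> C_n n (\<lambda>x. \<phi> x + \<psi> x)"
proof (induction n arbitrary: \<phi> \<psi>)
  case 0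
  then show ?case by (auto intro: continuous_intros)
next
  case (Suc n)
  then obtain \<phi>' \<psi>' where
    "\<And>x. (\<phi> has_real_derivative \<phi>' x) (at x)" "C_n n \<phi>'"
    "\<And>x. (\<psi> has_real_derivative \<psi>' x) (at x)" "C_n n \<psi>'"
    unfolding C_n_Suc_real_iff by blast
  then show ?case
    unfolding C_n_Suc_real_iff using Suc.IH
    by (intro exI[of _ "\<lambda>x. \<phi>' x + \<psi>' x"]) (auto intro: DERIV_add)
qed

lemma C_n_mult:
  fixes \<phi> \<psi> :: "real \<Rightarrow> real"
  shows "C_n n \<phi> \<Longrightarrow> C_n n \<psi> \<Longrightarrow> C_n n (\<lambda>x. \<phi> x * \<psi> x)"
proof (induction n arbitrary: \<phi> \<psi>)
  case 0
  then show ?case by (auto intro: continuous_intros)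
next
  case (Suc n)
  then obtain \<phi>' \<psi>' where
    "\<And>x. (\<phi> has_real_derivative \<phi>' x) (at x)" "C_n n \<phi>'"
    "\<And>x. (\<psi> has_real_derivative \<psi>' x) (at x)" "C_n n \<psi>'"
    unfolding C_n_Suc_real_iff by blast
  \<comment> \<open>The product rule leaves \<open>\<phi>\<close> and \<open>\<psi>\<close>
    themselves as factors of the derivative, so they are needed at the lower order as well.\<close>
  moreover have "C_n n \<phi>" "C_n n \<psi>" using Suc.prems C_n_SucD by blast+
  ultimately show ?case
    unfolding C_n_Suc_real_iff using Suc.IH
    by (intro exI[of _ "\<lambda>x. \<phi>' x * \<psi> x + \<psi>' x * \<phi> x"]) (auto intro!: C_n_add DERIV_mult)
qed

lemma C_n_const: "C_n n (\<lambda>x :: real. c :: real)"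
proof (induction n arbitrary: c)
  case (Suc n)
  then show ?case
    unfolding C_n_Suc_real_iff by (intro exI[of _ "\<lambda>x. 0"]) auto
qed auto

lemma C_n_affine:
  fixes \<phi> :: "real \<Rightarrow> real"
  shows "C_n n \<phi> \<Longrightarrow> C_n n (\<lambda>x. \<phi> (d + c * x))"
proof (induction n arbitrary: \<phi>)
  case 0
  then show ?case
    by (auto intro!: continuous_intros continuous_on_compose2[of UNIV \<phi>])
next
  case (Suc n)
  then obtain \<phi>' where \<phi>': "\<And>x. (\<phi> has_real_derivative \<phi>' x) (at x)" "C_n n \<phi>'"
    unfolding C_n_Suc_real_iff by blast
  have "((\<lambda>x. d + c * x) has_real_derivative c) (at x)" for x
    by (auto intro!: derivative_eq_intros)
  then have "((\<lambda>x. \<phi> (d + c * x)) has_real_derivative c * \<phi>' (d + c * x)) (at x)" for x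
    using DERIV_chain2[OF \<phi>'(1)] by (metis mult.commute)
  then show ?case
    unfolding C_n_Suc_real_iff using Suc.IH[OF \<phi>'(2)] C_n_mult[OF C_n_const] by fast
qed

text \<open>For \<open>p = 1\<close> this is the classical smooth function exp (-1/x), extended by 0
  to x \<le> 0. The polynomial in 1/x is carried along because the family is then closed under
  differentiation.\<close>

definition flat :: "real poly \<Rightarrow> real \<Rightarrow> real" where
  "flat p x = (if x > 0 then poly p (inverse x) * exp (- inverse x) else 0)"

lemma poly_div_exp_tendsto_0: "((\<lambda>x::real. poly p x * exp (- x)) \<longlongrightarrow> 0) at_top"
proof -
  have "((\<lambda>x. \<Sum>i\<le>degree p. coeff p i * (x ^ i / exp x)) \<longlongrightarrow> (\<Sum>i\<le>degree p. coeff p i * 0)) at_top"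
    by (intro tendsto_intros tendsto_power_div_exp_0)
  then show ?thesis
    by (simp add: poly_altdef exp_minus field_simps flip: sum_divide_distrib)
qed

text \<open>The substitution y = 1/x sends the right-hand limit at 0 to infinity, where the
  exponential beats every polynomial.\<close>

lemma flat_tendsto_0: "(flat p \<longlongrightarrow> 0) (at 0)"
proof -
  have "((\<lambda>x. poly p (inverse x) * exp (- inverse x)) \<longlongrightarrow> 0) (at_right 0)"
    using filterlim_compose[OF poly_div_exp_tendsto_0 filterlim_inverse_at_top_right] .
  then have "(flat p \<longlongrightarrow> 0) (at_right 0)"
    by (rule Lim_transform_eventually) (auto simp: flat_def eventually_at_filter)
  moreover have "(flat p \<longlongrightarrow> 0) (at_left 0)"
    by (rule tendsto_eventually) (auto simp: flat_def eventually_at_filter)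
  ultimately show ?thesis by (simp add: filterlim_split_at)
qed

text \<open>With y = 1/x one has dy/dx = - y^2, so P(y) exp(-y) differentiates to y^2 (P(y) - P'(y))
  exp(-y).\<close>

lemma flat_has_real_derivative:
  "(flat p has_real_derivative flat ([:0, 0, 1:] * (p - pderiv p)) x) (at x)"
proof -
  consider "x < 0" | "x > 0" | "x = 0" by linarith
  then show ?thesis
  proof cases
    case 1
    have "eventually (\<lambda>y. y \<in> {..<0}) (nhds x)"
      by (rule eventually_nhds_in_open) (use 1 in auto)
    then have "eventually (\<lambda>y. flat p y = 0) (nhds x)"
      by eventually_elim (simp add: flat_def)
    then show ?thesis using 1 by (subst DERIV_cong_ev[OF refl _ refl]) (auto simp: flat_def)
  next
    case 2
    have "eventually (\<lambda>y. y \<in> {0<..}) (nhds x)"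
      by (rule eventually_nhds_in_open) (use 2 in auto)
    then have "eventually (\<lambda>y. flat p y = poly p (inverse y) * exp (- inverse y)) (nhds x)"
      by eventually_elim (simp add: flat_def)
    moreover have "((\<lambda>y. poly p (inverse y) * exp (- inverse y)) has_real_derivative
        flat ([:0, 0, 1:] * (p - pderiv p)) x) (at x)"
      using 2 by (auto intro!: derivative_eq_intros DERIV_chain2[OF poly_DERIV]
          simp: flat_def field_simps power2_eq_square)
    ultimately show ?thesis by (subst DERIV_cong_ev[OF refl _ refl])
  next
    case 3
    \<comment> \<open>Dividing by \<open>h\<close> multiplies the polynomial by its variable 1/h, so
      the difference quotient at 0 is again a member of the family and tends to 0.\<close>
    have "(\<lambda>h. (flat p (0 + h) - flat p 0) / h) = flat ([:0, 1:] * p)"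
      by (auto simp: flat_def fun_eq_iff field_simps)
    then show ?thesis
      using flat_tendsto_0[of "[:0, 1:] * p"] 3 by (simp add: DERIV_def flat_def)
  qed
qed

lemma C_n_flat: "C_n n (flat p)"
proof (induction n arbitrary: p)
  case 0
  then show ?case
    using DERIV_isCont[OF flat_has_real_derivative] by (simp add: continuous_on_eq_continuous_at)
next
  case (Suc n)
  then show ?case unfolding C_n_Suc_real_iff using flat_has_real_derivative by blast
qed

text \<open>The first factor is positive exactly for x > a, the second exactly for x < b, so the
  support is \<open>{a..b}\<close>. A large \<open>c\<close> steepens the flanks and brings the bump
  close to the indicator of the open interval.\<close>

lemma test_fun_flat:
  assumes "a < b" "c > 0" "{a..b} \<subseteq> \<Omega>"
  shows "test_fun \<Omega> (\<lambda>x. flat 1 (c * (x - a)) * flat 1 (c * (b - x)))"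
proof -
  have "{x. flat 1 (c * (x - a)) * flat 1 (c * (b - x)) \<noteq> 0} = {a<..<b}"
    using assms by (auto simp: flat_def zero_less_mult_iff)
  moreover have "C_n n (\<lambda>x. flat 1 (c * (x - a)) * flat 1 (c * (b - x)))" for n
    using C_n_mult[OF C_n_affine[OF C_n_flat, of n 1 "- c * a" c] C_n_affine[OF C_n_flat, of n 1 "c * b" "- c"]]
    by (simp add: algebra_simps)
  ultimately show ?thesis using assms by (simp add: test_fun_def)
qed

section \<open>The fundamental lemma of the calculus of variations\<close>

lemma flat_1_tendsto_1:
  assumes "y > 0"
  shows "(\<lambda>n. flat 1 (real (Suc n) * y)) \<longlonglongrightarrow> 1"
proof -
  have "(\<lambda>n. exp (- (inverse (real (Suc n)) * inverse y))) \<longlonglongrightarrow> exp (- (0 * inverse y))"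
    by (intro tendsto_intros LIMSEQ_inverse_real_of_nat)
  with assms show ?thesis by (simp add: flat_def)
qed

lemma flat_1_bounds: "0 \<le> flat 1 x" "flat 1 x \<le> 1"
  by (auto simp: flat_def)

lemma flat_1_measurable [measurable]: "flat 1 \<in> borel_measurable borel"
proof -
  have "flat 1 = (\<lambda>x. if x > 0 then exp (- inverse x) else 0)" by (auto simp: flat_def)
  then show ?thesis by simp
qed

text \<open>The positive and the negative part of \<open>h\<close> are densities of two measures
  that agree, with finite values, on all half-lines \<open>{x<..}\<close>. Such measures coincide,
  and densities are unique almost everywhere.\<close>

lemma AE_zero_if_integrals_greaterThan_zero:
  fixes h :: "real \<Rightarrow> real"
  assumes h: "integrable lborel h" and zero: "\<And>x. (LINT t:{x<..}|lborel. h t) = 0"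
  shows "AE x in lborel. h x = 0"
proof -
  define p where "p = (\<lambda>x. max 0 (h x))"
  define q where "q = (\<lambda>x. max 0 (- h x))"
  have [measurable]: "h \<in> borel_measurable borel" using h by auto
  have [measurable]: "p \<in> borel_measurable borel" "q \<in> borel_measurable borel"
    unfolding p_def q_def by measurable
  have int: "integrable lborel p" "integrable lborel q" unfolding p_def q_def using h by auto
  have sint: "set_integrable lborel {x<..} p" "set_integrable lborel {x<..} q" for x
    unfolding set_integrable_def by (auto intro!: integrable_mult_indicator[where 'b=real, simplified] int)
  have nn: "p t \<ge> 0" "q t \<ge> 0" for t by (auto simp: p_def q_def)
  have em: "emeasure (density lborel (\<lambda>x. ennreal (f x))) {x<..} = ennreal (LINT t:{x<..}|lborel. f t)"
    if "integrable lborel f" "\<And>t. f t \<ge> 0" for f :: "real \<Rightarrow> real" and x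
  proof -
    have [measurable]: "f \<in> borel_measurable borel" using that by auto
    have "emeasure (density lborel (\<lambda>x. ennreal (f x))) {x<..} = (\<integral>\<^sup>+t. ennreal (indicator {x<..} t *\<^sub>R f t) \<partial>lborel)"
      by (subst emeasure_density) (auto intro!: nn_integral_cong split: split_indicator)
    also have "\<dots> = ennreal (LINT t:{x<..}|lborel. f t)"
      unfolding set_lebesgue_integral_def using that
      by (intro nn_integral_eq_integral integrable_mult_indicator) auto
    finally show ?thesis .
  qed
  have "(LINT t:{x<..}|lborel. p t) - (LINT t:{x<..}|lborel. q t) = (LINT t:{x<..}|lborel. h t)" for x
    by (subst set_integral_diff(2)[symmetric, OF sint])
       (auto intro!: set_lebesgue_integral_cong simp: p_def q_def)
  then have eq: "(LINT t:{x<..}|lborel. p t) = (LINT t:{x<..}|lborel. q t)" for x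
    using zero by (metis eq_iff_diff_eq_0)
  have "density lborel (\<lambda>x. ennreal (p x)) = density lborel (\<lambda>x. ennreal (q x))"
    by (rule measure_eqI_lessThan)
       (simp_all add: em[OF int(1) nn(1)] em[OF int(2) nn(2)] eq)
  then have "AE x in lborel. ennreal (p x) = ennreal (q x)"
    by (intro sigma_finite_measure.density_unique[OF lborel.sigma_finite_measure_axioms]) auto
  then show ?thesis
    by eventually_elim (auto simp: p_def q_def max_def split: if_splits)
qed

text \<open>Steepening bumps supported in \<open>{a..b}\<close> are admissible test functions and
  converge to 1 inside the interval. Dominated convergence with majorant |h| carries the vanishing
  over to the integral of \<open>h\<close>.\<close>

lemma set_integral_zero_if_test_integrals_zero:
  fixes h :: "real \<Rightarrow> real"
  assumes "a < b" "{a..b} \<subseteq> \<Omega>" "set_integrable lborel {a..b} h"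
    and zero: "\<And>\<phi>. test_fun \<Omega> \<phi> \<Longrightarrow> (LINT x:\<Omega>|lborel. h x * \<phi> x) = 0"
  shows "(LINT x:{a..b}|lborel. h x) = 0"
proof -
  define \<phi> where "\<phi> = (\<lambda>n x. flat 1 (real (Suc n) * (x - a)) * flat 1 (real (Suc n) * (b - x)))"
  define H where "H = (\<lambda>x. indicator {a..b} x *\<^sub>R h x)"
  have int: "integrable lborel H" using assms by (simp add: set_integrable_def H_def)
  then have [measurable]: "H \<in> borel_measurable borel" by auto
  have "(\<lambda>n. LINT x|lborel. H x * \<phi> n x) \<longlonglongrightarrow> (LINT x|lborel. H x)"
  proof (rule integral_dominated_convergence)
    show "integrable lborel (\<lambda>x. \<bar>H x\<bar>)" using int by simp
    show "AE x in lborel. (\<lambda>n. H x * \<phi> n x) \<longlonglongrightarrow> H x"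
      \<comment> \<open>At the two end points all bumps vanish, so convergence to \<open>H\<close>
        may fail there.\<close>
      using AE_lborel_singleton[of a] AE_lborel_singleton[of b]
    proof eventually_elim
      case (elim x)
      show ?case
      proof (cases "x \<in> {a<..<b}")
        case True
        then have "(\<lambda>n. H x * \<phi> n x) \<longlonglongrightarrow> H x * (1 * 1)"
          unfolding \<phi>_def by (intro tendsto_intros flat_1_tendsto_1) auto
        then show ?thesis by simp
      qed (use elim in \<open>auto simp: H_def indicator_def\<close>)
    qed
    show "AE x in lborel. norm (H x * \<phi> n x) \<le> \<bar>H x\<bar>" for n
    proof (intro AE_I2)
      fix x
      have "\<bar>\<phi> n x\<bar> \<le> 1 * 1"
        unfolding \<phi>_def abs_mult using flat_1_bounds by (intro mult_mono) (auto simp: abs_of_nonneg)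
      then show "norm (H x * \<phi> n x) \<le> \<bar>H x\<bar>" by (simp add: abs_mult mult_left_le)
    qed
  qed (auto simp: \<phi>_def)
  moreover have "(LINT x|lborel. H x * \<phi> n x) = 0" for n
  proof -
    have "(LINT x|lborel. H x * \<phi> n x) = (LINT x:\<Omega>|lborel. h x * \<phi> n x)"
      unfolding set_lebesgue_integral_def
    proof (intro Bochner_Integration.integral_cong refl)
      fix x
      show "H x * \<phi> n x = indicator \<Omega> x *\<^sub>R (h x * \<phi> n x)"
      proof (cases "x \<in> {a..b}")
        case True
        then have "x \<in> \<Omega>" using assms by auto
        then show ?thesis using True by (simp add: H_def)
      next
        case False
        then have "\<phi> n x = 0" using assms by (auto simp: \<phi>_def flat_def zero_less_mult_iff)
        then show ?thesis by simp
      qed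
    qed
    also have "\<dots> = 0" unfolding \<phi>_def using assms by (intro zero test_fun_flat) auto
    finally show ?thesis .
  qed
  ultimately show ?thesis
    by (simp add: H_def set_lebesgue_integral_def LIMSEQ_const_iff)
qed

text \<open>An open set is a countable union of compact intervals, so it suffices to treat
  \<open>h\<close> cut off to one of them. Half-line integrals of the cut-off are integrals over
  subintervals, which the preceding lemma annihilates.\<close>

lemma AE_zero_if_test_integrals_zero:
  fixes h :: "real \<Rightarrow> real"
  assumes "open \<Omega>" and h: "\<And>a b. {a..b} \<subseteq> \<Omega> \<Longrightarrow> set_integrable lborel {a..b} h"
    and zero: "\<And>\<phi>. test_fun \<Omega> \<phi> \<Longrightarrow> (LINT x:\<Omega>|lborel. h x * \<phi> x) = 0"
  shows "AE x in lborel. x \<in> \<Omega> \<longrightarrow> h x = 0"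
proof -
  obtain D where D: "countable D" "D \<subseteq> Pow \<Omega>" "\<forall>X\<in>D. \<exists>a b::real. X = cbox a b" "\<Union>D = \<Omega>"
    using open_countable_Union_open_cbox[OF \<open>open \<Omega>\<close>] by metis
  have "AE x in lborel. x \<in> X \<longrightarrow> h x = 0" if "X \<in> D" for X
  proof -
    obtain a b where "X = cbox a b" using D(3) \<open>X \<in> D\<close> by blast
    then have X: "X = {a..b}" by (simp add: cbox_interval)
    have sub: "{a..b} \<subseteq> \<Omega>" using D(2) that unfolding X by blast
    have "integrable lborel (\<lambda>x. indicator {a..b} x *\<^sub>R h x)"
      using h[OF sub] by (simp add: set_integrable_def)
    moreover have "(LINT t:{x<..}|lborel. indicator {a..b} t *\<^sub>R h t) = 0" for x
    proof -
      \<comment> \<open>\<open>{c..b}\<close> is \<open>{x<..} \<inter> {a..b}\<close> up to the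
        single point \<open>x\<close>.\<close>
      define c where "c = max x a"
      have "{c..b} \<subseteq> \<Omega>" using sub by (auto simp: c_def)
      have "(LINT t:{x<..}|lborel. indicator {a..b} t *\<^sub>R h t) = (LINT t:{x<..} \<inter> {a..b}|lborel. h t)"
        by (simp add: set_lebesgue_integral_def indicator_inter_arith mult.assoc)
      also have "\<dots> = (LINT t:{c..b}|lborel. h t)"
      proof (rule set_integral_cong_set)
        show "AE t in lborel. t \<in> {c..b} \<longleftrightarrow> t \<in> {x<..} \<inter> {a..b}"
          using AE_lborel_singleton[of x] by eventually_elim (auto simp: c_def)
        have "set_borel_measurable lborel {a..b} h"
          using h[OF sub] by (auto simp: set_integrable_def set_borel_measurable_def)
        then show "set_borel_measurable lborel {c..b} h" "set_borel_measurable lborel ({x<..} \<inter> {a..b}) h"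
          by (auto intro!: set_borel_measurable_subset[of _ "{a..b}"] simp: c_def)
      qed
      also have "\<dots> = 0"
      proof (cases "c < b")
        case True
        then show ?thesis
          using set_integral_zero_if_test_integrals_zero[OF True \<open>{c..b} \<subseteq> \<Omega>\<close> h zero] \<open>{c..b} \<subseteq> \<Omega>\<close> by simp
      next
        case False
        then have "{c..b} \<subseteq> {c}" by auto
        then show ?thesis
          using AE_lborel_singleton[of c]
          by (auto simp: set_lebesgue_integral_def split: split_indicator intro!: integral_eq_zero_AE elim!: eventually_mono)
      qed
      finally show ?thesis .
    qed
    ultimately have "AE x in lborel. indicator {a..b} x *\<^sub>R h x = 0"
      by (rule AE_zero_if_integrals_greaterThan_zero)
    then show ?thesis by eventually_elim (auto simp: X)
  qed
  then have "AE x in lborel. \<forall>X\<in>D. x \<in> X \<longrightarrow> h x = 0"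
    by (subst AE_ball_countable[OF D(1)]) blast
  then show ?thesis by eventually_elim (use D(4) in auto)
qed

section \<open>Square integrable functions and weak derivatives\<close>

text \<open>The indicator equals its own square, so extension by zero commutes with squaring and
  questions on a set become questions on the whole space.\<close>

lemma L2_iff_integrable:
  fixes f :: "'a::euclidean_space \<Rightarrow> real"
  shows "L2 S f \<longleftrightarrow> (\<lambda>x. indicator S x * f x) \<in> borel_measurable borel \<and>
    integrable lborel (\<lambda>x. (indicator S x * f x)\<^sup>2)"
proof -
  have "(indicator S x * f x)\<^sup>2 = indicator S x * (f x)\<^sup>2" for x
    by (simp add: indicator_def)
  then show ?thesis
    by (simp add: L2_def set_borel_measurable_def set_integrable_def)
qed

lemma L2_subset:
  assumes "L2 A f" "B \<subseteq> A" "B \<in> sets borel"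
  shows "L2 B f"
  using assms set_borel_measurable_subset[of lborel A f B] set_integrable_subset[of lborel A "\<lambda>x. (f x)\<^sup>2" B]
  by (simp add: L2_def)

lemma L2_linear:
  assumes "L2 S f" "L2 S g"
  shows "L2 S (\<lambda>x. a * f x + b * g x)"
proof -
  let ?f = "\<lambda>x. indicator S x * f x" and ?g = "\<lambda>x. indicator S x * g x"
  have [measurable]: "?f \<in> borel_measurable borel" "?g \<in> borel_measurable borel"
    using assms by (auto simp: L2_iff_integrable)
  have int: "integrable lborel (\<lambda>x. 2 * a\<^sup>2 * (?f x)\<^sup>2 + 2 * b\<^sup>2 * (?g x)\<^sup>2)"
    using assms by (intro Bochner_Integration.integrable_add integrable_mult_right)
      (auto simp: L2_iff_integrable)
  have "integrable lborel (\<lambda>x. (a * ?f x + b * ?g x)\<^sup>2)"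
  proof (rule Bochner_Integration.integrable_bound[OF int])
    \<comment> \<open>The two sides differ by (a y - b z)^2.\<close>
    have "(a * y + b * z)\<^sup>2 \<le> 2 * a\<^sup>2 * y\<^sup>2 + 2 * b\<^sup>2 * z\<^sup>2" for y z :: real
      using zero_le_power2[of "a * y - b * z"] by (simp add: power2_eq_square algebra_simps)
    then show "AE x in lborel. norm ((a * ?f x + b * ?g x)\<^sup>2) \<le> norm (2 * a\<^sup>2 * (?f x)\<^sup>2 + 2 * b\<^sup>2 * (?g x)\<^sup>2)"
      by (intro AE_I2) (auto intro: order_trans[OF _ abs_ge_self])
  qed measurable
  moreover have "(\<lambda>x. a * ?f x + b * ?g x) \<in> borel_measurable borel" by measurable
  moreover have "a * ?f x + b * ?g x = indicator S x * (a * f x + b * g x)" for x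
    by (simp add: algebra_simps)
  ultimately show ?thesis by (simp add: L2_iff_integrable)
qed

lemma set_borel_measurable_Un:
  fixes f :: "'a \<Rightarrow> real"
  assumes "set_borel_measurable M A f" "set_borel_measurable M B f" "A \<in> sets M" "B \<in> sets M"
  shows "set_borel_measurable M (A \<union> B) f"
proof -
  have "set_borel_measurable M (B - A) f"
    using set_borel_measurable_subset assms by (metis Diff_subset sets.Diff)
  then have "(\<lambda>x. indicator A x *\<^sub>R f x + indicator (B - A) x *\<^sub>R f x) \<in> borel_measurable M"
    using assms(1) unfolding set_borel_measurable_def by (rule borel_measurable_add[rotated])
  moreover have "indicator A x *\<^sub>R f x + indicator (B - A) x *\<^sub>R f x = indicator (A \<union> B) x *\<^sub>R f x" for x
    by (simp split: split_indicator)
  ultimately show ?thesis by (simp add: set_borel_measurable_def)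
qed

lemma L2_Un:
  assumes "L2 A f" "L2 B f" "A \<in> sets borel" "B \<in> sets borel"
  shows "L2 (A \<union> B) f"
  using assms set_borel_measurable_Un[of lborel A f B] set_integrable_Un[of lborel A "\<lambda>x. (f x)\<^sup>2" B]
  by (simp add: L2_def)

text \<open>\<open>lborel\<close> is not complete, so equality almost everywhere does not transport
  measurability; it enters as a hypothesis of its own.\<close>

lemma L2_cong_AE:
  assumes "L2 S f" "set_borel_measurable lborel S g" "AE x in lborel. x \<in> S \<longrightarrow> f x = g x"
  shows "L2 S g"
proof -
  have "integrable lborel (\<lambda>x. (indicator S x * g x)\<^sup>2)"
    using assms(1,2)
    by (subst integrable_cong_AE[of _ _ "\<lambda>x. (indicator S x * f x)\<^sup>2"])
      (use assms(3) in \<open>auto simp: L2_iff_integrable set_borel_measurable_def split: split_indicator elim!: eventually_mono\<close>)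
  then show ?thesis using assms(2) by (simp add: L2_iff_integrable set_borel_measurable_def)
qed

lemma L2_affine:
  fixes f :: "real \<Rightarrow> real"
  assumes "L2 S f" "c \<noteq> 0"
  shows "L2 {x. d + c * x \<in> S} (\<lambda>x. f (d + c * x))"
proof -
  have "indicator {x. d + c * x \<in> S} x = (indicator S (d + c * x) :: real)" for x
    by (simp add: indicator_def)
  moreover have "(\<lambda>x. indicator S (d + c * x) * f (d + c * x)) \<in> borel_measurable borel"
    by (rule measurable_compose[of "\<lambda>x. d + c * x" _ borel "\<lambda>y. indicator S y * f y"])
      (use assms in \<open>auto simp: L2_iff_integrable\<close>)
  ultimately show ?thesis
    using assms lborel_integrable_real_affine[of "\<lambda>y. (indicator S y * f y)\<^sup>2" c d]
    by (simp add: L2_iff_integrable)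
qed

lemma set_integral_affine:
  fixes f :: "real \<Rightarrow> real"
  assumes "c \<noteq> 0"
  shows "(LINT x:S|lborel. f x) = \<bar>c\<bar> * (LINT x:{x. d + c * x \<in> S}|lborel. f (d + c * x))"
proof -
  have "indicator {x. d + c * x \<in> S} x = (indicator S (d + c * x) :: real)" for x
    by (simp add: indicator_def)
  then show ?thesis
    using lborel_integral_real_affine[OF assms, of "\<lambda>x. indicator S x * f x" d]
    by (simp add: set_lebesgue_integral_def)
qed

text \<open>|y| \<le> 1 + y^2, and constants are integrable over a bounded set.\<close>

lemma L2_imp_set_integrable:
  assumes "L2 S f" "bounded S" "S \<in> sets borel"
  shows "set_integrable lborel S f"
proof (rule set_integrable_bound)
  have "set_integrable lborel S (\<lambda>x. 1 :: real)"
    using assms emeasure_bounded_finite[of S]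
    by (simp add: set_integrable_def)
  then show "set_integrable lborel S (\<lambda>x. 1 + (f x)\<^sup>2)"
    using assms(1) by (intro set_integral_add) (auto simp: L2_def)
  have "\<bar>y\<bar> \<le> \<bar>1 + y\<^sup>2\<bar>" for y :: real
    using zero_le_power2[of "\<bar>y\<bar> - 1"] by (simp add: power2_eq_square algebra_simps)
  then show "AE x in lborel. x \<in> S \<longrightarrow> norm (f x) \<le> norm (1 + (f x)\<^sup>2)"
    by (intro AE_I2) simp
qed (use assms in \<open>auto simp: L2_def\<close>)

section \<open>Local square integrability\<close>

lemma L2_imp_L2_loc: "L2 \<Omega> f \<Longrightarrow> L2_loc \<Omega> f"
  using L2_subset by (metis L2_loc_def borel_compact)

lemma L2_loc_subset: "L2_loc A f \<Longrightarrow> B \<subseteq> A \<Longrightarrow> L2_loc B f"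
  by (auto simp: L2_loc_def)

lemma L2_loc_linear: "L2_loc \<Omega> f \<Longrightarrow> L2_loc \<Omega> g \<Longrightarrow> L2_loc \<Omega> (\<lambda>x. a * f x + b * g x)"
  by (auto simp: L2_loc_def intro: L2_linear)

lemma uminus_image_eq: "uminus ` S = {x. - x \<in> S}" for S :: "'a::group_add set"
  unfolding set_eq_iff image_iff by (metis mem_Collect_eq minus_minus)

lemma L2_loc_reflect:
  fixes f :: "real \<Rightarrow> real"
  assumes "L2_loc \<Omega> f"
  shows "L2_loc (uminus ` \<Omega>) (\<lambda>x. f (- x))"
  unfolding L2_loc_def
proof safe
  fix K :: "real set" assume K: "compact K" "K \<subseteq> uminus ` \<Omega>"
  then have "L2 (uminus ` K) f"
    using assms compact_negations[of K] by (force simp: L2_loc_def)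
  then have "L2 {x. - x \<in> uminus ` K} (\<lambda>x. f (- x))"
    using L2_affine[of _ f "-1" 0] by simp
  then show "L2 K (\<lambda>x. f (- x))" by (simp add: image_iff)
qed

text \<open>Local square integrability yields measurability on compact sets only; countably many
  boxes exhausting the open set glue these pieces together.\<close>

lemma L2_loc_imp_set_borel_measurable:
  assumes "L2_loc \<Omega> f" "open \<Omega>"
  shows "set_borel_measurable lborel \<Omega> f"
proof -
  obtain D where D: "countable D" "D \<subseteq> Pow \<Omega>" "\<forall>X\<in>D. \<exists>a b. X = cbox a b" "\<Union>D = \<Omega>"
    using open_countable_Union_open_cbox[OF \<open>open \<Omega>\<close>] by metis
  have "(\<lambda>x. indicator \<Omega> x * f x) \<in> borel_measurable borel"
  \<comment> \<open>The complement joins the boxes so that the pieces cover the whole space.\<close>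
  proof (rule measurable_piecewise_restrict[of "insert (- \<Omega>) D"])
    fix X assume X: "X \<in> insert (- \<Omega>) D"
    show "X \<inter> space borel \<in> sets borel"
      using X D(3) assms(2) by auto
    then have "X \<in> sets borel" by simp
    show "(\<lambda>x. indicator \<Omega> x * f x) \<in> measurable (restrict_space borel X) borel"
    proof (cases "X = - \<Omega>")
      case True
      then show ?thesis
        by (subst measurable_cong[of _ _ "\<lambda>_. 0"]) (auto simp: space_restrict_space)
    next
      case False
      then have "X \<in> D" using X by auto
      then obtain a b where "X = cbox a b" using D(3) by blast
      then have "compact X" by simp
      moreover have "X \<subseteq> \<Omega>" using D(2) \<open>X \<in> D\<close> by blast
      ultimately have "L2 X f" using assms(1) by (auto simp: L2_loc_def)
      moreover have "(\<lambda>x. indicator X x *\<^sub>R (indicator \<Omega> x * f x)) = (\<lambda>x. indicator X x * f x)"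
        using \<open>X \<in> D\<close> D(2) by (auto simp: indicator_def fun_eq_iff)
      ultimately show ?thesis
        using \<open>X \<in> sets borel\<close>
        by (subst borel_measurable_restrict_space_iff) (simp_all only: L2_iff_integrable sets.Int_space_eq2 space_borel Int_UNIV_right)
    qed
  qed (use D in auto)
  then show ?thesis by (simp add: set_borel_measurable_def)
qed

section \<open>Supports of test functions\<close>

lemma partial_deriv_eq_zero:
  assumes "x \<notin> closure {p. \<phi> p \<noteq> 0}"
  shows "partial_deriv b \<phi> x = 0"
proof -
  have "(\<phi> has_derivative (\<lambda>_. 0)) (at x)"
  proof (rule has_derivative_transform_within_open)
    show "((\<lambda>_. 0) has_derivative (\<lambda>_. 0)) (at x)" by simp
    show "open (- closure {p. \<phi> p \<noteq> 0})" "x \<in> - closure {p. \<phi> p \<noteq> 0}"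
      using assms by auto
  qed (use closure_subset[of "{p. \<phi> p \<noteq> 0}"] in auto)
  then show ?thesis
    unfolding partial_deriv_def using frechet_derivative_at by metis
qed

lemma test_fun_partial_deriv:
  assumes "test_fun \<Omega> \<phi>" "b \<in> Basis"
  shows "test_fun \<Omega> (partial_deriv b \<phi>)"
proof -
  have "{p. partial_deriv b \<phi> p \<noteq> 0} \<subseteq> closure {p. \<phi> p \<noteq> 0}"
    using partial_deriv_eq_zero by blast
  then have "closure {p. partial_deriv b \<phi> p \<noteq> 0} \<subseteq> closure {p. \<phi> p \<noteq> 0}"
    by (simp add: closure_minimal)
  moreover have "C_n n (partial_deriv b \<phi>)" for n
    using assms C_n.simps(2)[of n \<phi>] by (auto simp: test_fun_def simp del: C_n.simps)
  ultimately show ?thesis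
    using assms(1) unfolding test_fun_def
    by (meson bounded_subset closed_closure compact_eq_bounded_closed order_trans)
qed

lemma test_fun_zero_outside:
  assumes "test_fun \<Omega> \<phi>" "x \<notin> \<Omega>"
  shows "\<phi> x = 0"
  using assms closure_subset[of "{p. \<phi> p \<noteq> 0}"] by (auto simp: test_fun_def)

lemma test_fun_mono: "test_fun A \<phi> \<Longrightarrow> A \<subseteq> B \<Longrightarrow> test_fun B \<phi>"
  by (auto simp: test_fun_def)

text \<open>A test function is bounded and lives on a compact set, where \<open>w\<close> is square
  integrable and hence integrable.\<close>

lemma set_integrable_mult_test_fun:
  assumes w: "L2_loc \<Omega> w" and \<phi>: "test_fun \<Omega> \<phi>"
  shows "set_integrable lborel \<Omega> (\<lambda>x. w x * \<phi> x)"
proof -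
  define K where "K = closure {p. \<phi> p \<noteq> 0}"
  have K: "compact K" "K \<subseteq> \<Omega>" using \<phi> by (auto simp: test_fun_def K_def)
  have K0: "\<phi> x = 0" if "x \<notin> K" for x
    using that closure_subset[of "{p. \<phi> p \<noteq> 0}"] by (auto simp: K_def)
  have cont: "continuous_on UNIV \<phi>" using \<phi> C_n.simps(1) by (auto simp: test_fun_def simp del: C_n.simps)
  then have [measurable]: "\<phi> \<in> borel_measurable borel" by (rule borel_measurable_continuous_onI)
  have "bounded (\<phi> ` K)"
    using cont K(1) continuous_on_subset by (intro compact_imp_bounded compact_continuous_image) auto
  then obtain M where M: "\<And>x. x \<in> K \<Longrightarrow> \<bar>\<phi> x\<bar> \<le> M" unfolding bounded_iff by auto
  have "L2 K w" using w K by (auto simp: L2_loc_def)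
  then have int: "set_integrable lborel K w"
    using K by (intro L2_imp_set_integrable) (auto simp: compact_imp_bounded borel_compact)
  then have [measurable]: "(\<lambda>x. indicator K x *\<^sub>R w x) \<in> borel_measurable borel"
    by (auto simp: set_integrable_def)
  have "integrable lborel (\<lambda>x. M * (indicator K x *\<^sub>R w x))"
    using int by (auto simp: set_integrable_def)
  then have "integrable lborel (\<lambda>x. \<phi> x * (indicator K x *\<^sub>R w x))"
  proof (rule Bochner_Integration.integrable_bound)
    show "AE x in lborel. norm (\<phi> x * (indicator K x *\<^sub>R w x)) \<le> norm (M * (indicator K x *\<^sub>R w x))"
      by (intro AE_I2) (auto simp: abs_mult indicator_def intro!: mult_right_mono order_trans[OF M])
  qed measurable
  moreover have "(\<lambda>x. \<phi> x * (indicator K x *\<^sub>R w x)) = (\<lambda>x. indicator \<Omega> x *\<^sub>R (w x * \<phi> x))"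
    using K0 K(2) by (auto simp: indicator_def fun_eq_iff)
  ultimately show ?thesis unfolding set_integrable_def by argo
qed

section \<open>Rules for weak derivatives\<close>

lemma weak_deriv_linear:
  assumes "weak_deriv \<Omega> b v v'" "weak_deriv \<Omega> b w w'" "b \<in> Basis"
    and "L2_loc \<Omega> v" "L2_loc \<Omega> v'" "L2_loc \<Omega> w" "L2_loc \<Omega> w'"
  shows "weak_deriv \<Omega> b (\<lambda>x. c * v x + d * w x) (\<lambda>x. c * v' x + d * w' x)"
  unfolding weak_deriv_def
proof safe
  fix \<phi> assume \<phi>: "test_fun \<Omega> \<phi>"
  note int = set_integrable_mult_test_fun[OF _ \<phi>]
    set_integrable_mult_test_fun[OF _ test_fun_partial_deriv[OF \<phi> \<open>b \<in> Basis\<close>]]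
  \<comment> \<open>Integrals are split only for integrable summands; local square integrability
    provides these through \<open>int\<close>.\<close>
  have lin: "(LINT x:\<Omega>|lborel. (c * f x + d * g x) * \<psi> x)
      = c * (LINT x:\<Omega>|lborel. f x * \<psi> x) + d * (LINT x:\<Omega>|lborel. g x * \<psi> x)"
    if "set_integrable lborel \<Omega> (\<lambda>x. f x * \<psi> x)" "set_integrable lborel \<Omega> (\<lambda>x. g x * \<psi> x)"
    for f g \<psi> :: "'a \<Rightarrow> real"
    using that set_integral_add(2)[of lborel \<Omega> "\<lambda>x. c * (f x * \<psi> x)" "\<lambda>x. d * (g x * \<psi> x)"]
    by (simp add: algebra_simps)
  show "(LINT x:\<Omega>|lborel. (c * v x + d * w x) * partial_deriv b \<phi> x)
      = - (LINT x:\<Omega>|lborel. (c * v' x + d * w' x) * \<phi> x)"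
    using assms \<phi> by (simp add: lin int weak_deriv_def)
qed

text \<open>A test function on the smaller set is one on the larger set, and it vanishes with its
  derivative on the difference, so both integrals are unchanged.\<close>

lemma weak_deriv_subset:
  assumes "weak_deriv A b w w'" "B \<subseteq> A"
  shows "weak_deriv B b w w'"
  unfolding weak_deriv_def
proof safe
  fix \<phi> assume \<phi>: "test_fun B \<phi>"
  have "(LINT x:B|lborel. f x * \<phi> x) = (LINT x:A|lborel. f x * \<phi> x)" for f
    unfolding set_lebesgue_integral_def
    using test_fun_zero_outside[OF \<phi>] assms(2)
    by (intro Bochner_Integration.integral_cong) (auto simp: indicator_def)
  moreover have "(LINT x:B|lborel. f x * partial_deriv b \<phi> x) = (LINT x:A|lborel. f x * partial_deriv b \<phi> x)" for f
    unfolding set_lebesgue_integral_def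
    using partial_deriv_eq_zero[of _ \<phi> b] assms(2) \<phi> unfolding test_fun_def
    by (intro Bochner_Integration.integral_cong) (auto simp: indicator_def)
  ultimately show "(LINT x:B|lborel. w x * partial_deriv b \<phi> x) = - (LINT x:B|lborel. w' x * \<phi> x)"
    using assms test_fun_mono[OF \<phi>] by (simp add: weak_deriv_def)
qed

text \<open>Test against \<open>\<phi> (- x)\<close> and substitute; the chain rule supplies the
  sign. This serves to compare \<open>g (- x)\<close> with \<open>f x\<close> on (0,1).\<close>

lemma weak_deriv_reflect:
  assumes "weak_deriv \<Omega> 1 w w'"
  shows "weak_deriv (uminus ` \<Omega>) 1 (\<lambda>x::real. w (- x)) (\<lambda>x. - w' (- x))"
  unfolding weak_deriv_def
proof safe
  fix \<phi> :: "real \<Rightarrow> real" assume \<phi>: "test_fun (uminus ` \<Omega>) \<phi>"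
  have "{x. \<phi> (- x) \<noteq> 0} = uminus ` {x. \<phi> x \<noteq> 0}"
    by (simp add: uminus_image_eq)
  then have "closure {x. \<phi> (- x) \<noteq> 0} = uminus ` closure {x. \<phi> x \<noteq> 0}"
    using closure_scaleR[of "- 1" "{x. \<phi> x \<noteq> 0}"] by simp
  moreover have "C_n n (\<lambda>x. \<phi> (- x))" for n
    using \<phi> C_n_affine[of n \<phi> 0 "-1"] by (simp add: test_fun_def)
  ultimately have "test_fun \<Omega> (\<lambda>x. \<phi> (- x))"
    using \<phi> compact_negations[of "uminus ` closure {x. \<phi> x \<noteq> 0}"] compact_negations[of "closure {x. \<phi> x \<noteq> 0}"]
    by (auto simp: test_fun_def)
  then have "(LINT x:\<Omega>|lborel. w x * partial_deriv 1 (\<lambda>x. \<phi> (- x)) x) = - (LINT x:\<Omega>|lborel. w' x * \<phi> (- x))"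
    using assms by (simp add: weak_deriv_def)
  moreover have "partial_deriv 1 (\<lambda>x. \<phi> (- x)) x = - partial_deriv 1 \<phi> (- x)" for x
  proof (rule partial_deriv_real)
    have "C_n (Suc 0) \<phi>" using \<phi> by (simp add: test_fun_def del: C_n.simps)
    then have "(\<phi> has_real_derivative partial_deriv 1 \<phi> (- x)) (at (- x))"
      using has_real_derivative_partial_deriv by auto
    then show "((\<lambda>x. \<phi> (- x)) has_real_derivative - partial_deriv 1 \<phi> (- x)) (at x)"
      by (simp flip: DERIV_mirror)
  qed
  moreover have reflect: "(LINT x:\<Omega>|lborel. f x) = (LINT x:uminus ` \<Omega>|lborel. f (- x))" for f :: "real \<Rightarrow> real"
  proof -
    show ?thesis using set_integral_affine[of "-1" \<Omega> f 0] by (simp add: uminus_image_eq)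
  qed
  ultimately show "(LINT x:uminus ` \<Omega>|lborel. w (- x) * partial_deriv 1 \<phi> x)
      = - (LINT x:uminus ` \<Omega>|lborel. - w' (- x) * \<phi> x)"
    by (simp add: set_lebesgue_integral_def)
qed

text \<open>Since \<open>v - w\<close> vanishes almost everywhere, \<open>v' - w'\<close> integrates
  to 0 against every test function, and the fundamental lemma applies.\<close>

lemma weak_deriv_unique_AE:
  fixes v w :: "real \<Rightarrow> real"
  assumes "open \<Omega>" and v: "weak_deriv \<Omega> 1 v v'" and w: "weak_deriv \<Omega> 1 w w'"
    and loc: "L2_loc \<Omega> v" "L2_loc \<Omega> v'" "L2_loc \<Omega> w" "L2_loc \<Omega> w'"
    and eq: "AE x in lborel. x \<in> \<Omega> \<longrightarrow> v x = w x"
  shows "AE x in lborel. x \<in> \<Omega> \<longrightarrow> v' x = w' x"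
proof -
  have loc': "L2_loc \<Omega> (\<lambda>x. 1 * v' x + (- 1) * w' x)" using loc by (intro L2_loc_linear)
  have "AE x in lborel. x \<in> \<Omega> \<longrightarrow> 1 * v' x + (- 1) * w' x = 0"
  proof (rule AE_zero_if_test_integrals_zero[OF \<open>open \<Omega>\<close>])
    fix a b :: real assume "{a..b} \<subseteq> \<Omega>"
    then show "set_integrable lborel {a..b} (\<lambda>x. 1 * v' x + (- 1) * w' x)"
      using loc' by (intro L2_imp_set_integrable) (auto simp: L2_loc_def)
  next
    fix \<phi> assume \<phi>: "test_fun \<Omega> \<phi>"
    have "(LINT x:\<Omega>|lborel. (1 * v x + (- 1) * w x) * partial_deriv 1 \<phi> x) = 0"
      unfolding set_lebesgue_integral_def
      by (rule integral_eq_zero_AE) (use eq in \<open>auto simp: indicator_def elim!: eventually_mono\<close>)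
    then show "(LINT x:\<Omega>|lborel. (1 * v' x + (- 1) * w' x) * \<phi> x) = 0"
      using weak_deriv_linear[OF v w _ loc, of 1 "- 1"] \<phi> by (simp add: weak_deriv_def)
  qed
  then show ?thesis by eventually_elim auto
qed

section \<open>Integrals over intervals\<close>

lemma L2_cong: "L2 S f \<Longrightarrow> (\<And>x. x \<in> S \<Longrightarrow> f x = g x) \<Longrightarrow> L2 S g"
proof -
  assume f: "L2 S f" and eq: "\<And>x. x \<in> S \<Longrightarrow> f x = g x"
  have "indicator S x * f x = indicator S x * g x" for x
    using eq by (auto simp: indicator_def)
  then show ?thesis using f unfolding L2_iff_integrable by presburger
qed

text \<open>On one point \<open>f\<close> agrees with a constant. Later this fills the gap at time 0
  between the history and the solution.\<close>

lemma L2_singleton: "L2 {a} f"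
proof (rule L2_cong)
  show "L2 {a} (\<lambda>_. f a)"
    using integrable_real_indicator[of "{a}" lborel]
    by (simp add: L2_def set_integrable_def set_borel_measurable_def)
qed simp

lemma L2_loc_imp_L2_atLeastAtMost: "L2_loc \<Omega> f \<Longrightarrow> {a..b::real} \<subseteq> \<Omega> \<Longrightarrow> L2 {a..b} f"
  by (simp add: L2_loc_def)

lemma L2_affine_greaterThanLessThan:
  fixes f :: "real \<Rightarrow> real"
  assumes "L2 {d + c * a<..<d + c * b} f" "c > 0"
  shows "L2 {a<..<b} (\<lambda>x. f (d + c * x))"
  using L2_affine[OF assms(1), of c d] assms(2) by (simp add: greaterThanLessThan_def greaterThan_def lessThan_def Int_def)

lemma set_integral_affine_greaterThanLessThan:
  fixes f :: "real \<Rightarrow> real"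
  assumes "c > 0"
  shows "(LINT x:{d + c * a<..<d + c * b}|lborel. f x) = c * (LINT x:{a<..<b}|lborel. f (d + c * x))"
  using set_integral_affine[of c "{d + c * a<..<d + c * b}" f d] assms
  by (simp add: greaterThanLessThan_def greaterThan_def lessThan_def Int_def)

lemma L2_reflect_greaterThanLessThan:
  fixes f :: "real \<Rightarrow> real"
  assumes "L2 {d - b<..<d - a} f"
  shows "L2 {a<..<b} (\<lambda>x. f (d - x))"
proof -
  have "{x. d + - 1 * x \<in> {d - b<..<d - a}} = {a<..<b}" by auto
  then show ?thesis using L2_affine[OF assms, of "- 1" d] by simp
qed

lemma set_integral_reflect_greaterThanLessThan:
  fixes f :: "real \<Rightarrow> real"
  shows "(LINT x:{a<..<b}|lborel. f (d - x)) = (LINT x:{d - b<..<d - a}|lborel. f x)"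
proof -
  have "{x. d + - 1 * x \<in> {d - b<..<d - a}} = {a<..<b}" by auto
  then show ?thesis using set_integral_affine[of "- 1" "{d - b<..<d - a}" f d] by simp
qed

lemma set_integral_split_greaterThanLessThan:
  fixes H :: "real \<Rightarrow> real"
  assumes "a \<le> b" "b \<le> c" "set_integrable lborel {a<..<c} H"
  shows "(LINT x:{a<..<c}|lborel. H x) = (LINT x:{a<..<b}|lborel. H x) + (LINT x:{b<..<c}|lborel. H x)"
proof -
  have int: "set_integrable lborel {a<..<b} H" "set_integrable lborel {b<..<c} H"
    "set_integrable lborel ({a<..<b} \<union> {b<..<c}) H"
    using assms by (auto intro!: set_integrable_subset[OF assms(3)])
  have "(LINT x:{a<..<c}|lborel. H x) = (LINT x:{a<..<b} \<union> {b<..<c}|lborel. H x)"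
  proof (rule set_integral_cong_set)
    show "AE x in lborel. x \<in> {a<..<b} \<union> {b<..<c} \<longleftrightarrow> x \<in> {a<..<c}"
      using AE_lborel_singleton[of b] by eventually_elim (use assms in auto)
  qed (use assms(3) int(3) in \<open>auto simp: set_integrable_def set_borel_measurable_def\<close>)
  also have "\<dots> = (LINT x:{a<..<b}|lborel. H x) + (LINT x:{b<..<c}|lborel. H x)"
    by (intro set_integral_Un int) auto
  finally show ?thesis .
qed

text \<open>Split the integral over \<open>{p<..<q'}\<close> once at \<open>p'\<close> and once at
  \<open>q\<close>. The order of \<open>p'\<close> and \<open>q\<close> is left open, so the windows
  may overlap or be disjoint.\<close>

lemma set_integral_moving_window:
  fixes H :: "real \<Rightarrow> real"
  assumes "p \<le> p'" "p' \<le> q'" "p \<le> q" "q \<le> q'" "set_integrable lborel {p<..<q'} H"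
  shows "(LINT x:{p'<..<q'}|lborel. H x) - (LINT x:{p<..<q}|lborel. H x)
    = (LINT x:{q<..<q'}|lborel. H x) - (LINT x:{p<..<p'}|lborel. H x)"
  using set_integral_split_greaterThanLessThan[of p p' q' H]
    set_integral_split_greaterThanLessThan[of p q q' H] assms by simp

section \<open>The energy increment\<close>

text \<open>\<open>dAlembert_rep\<close> gives no control of \<open>f'\<close> at \<open>0\<close> and of \<open>g'\<close> at \<open>-1\<close>; there
  square integrability comes from the initial data, which determine \<open>f'(x) \<plusminus> g'(-x)\<close> on \<open>(0,1)\<close>.\<close>

lemma weak_solution_L2_initial:
  assumes "weak_solution k \<mu>1 \<mu>2 \<tau> u0 u1 g0 u f g f' g'"
  shows "L2 {0<..<1} f'" and "L2 {-1<..<0} g'"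
proof -
  let ?I = "{0<..<1::real}"
  have f: "L2_loc {0<..} f" "L2_loc {0<..} f'" "weak_deriv {0<..} 1 f f'"
    and g: "L2_loc {-1<..} g" "L2_loc {-1<..} g'" "weak_deriv {-1<..} 1 g g'"
    and u1: "L2 ?I u1" and u0: "H1 ?I u0"
    and eq0: "AE x in lborel. 0 < x \<and> x < 1 \<longrightarrow> f x + g (- x) = u0 x"
    and eq1: "AE x in lborel. 0 < x \<and> x < 1 \<longrightarrow> u_t f' g' x 0 = u1 x"
    using assms by (auto simp: weak_solution_def dAlembert_rep_def H1_L_def)
  obtain u0' where u0': "L2 ?I u0'" "weak_deriv ?I 1 u0 u0'" and "L2 ?I u0"
    using u0 by (auto simp: H1_def)
  have sub: "?I \<subseteq> {0<..}" "?I \<subseteq> uminus ` {-1<..}" by (auto simp: uminus_image_eq)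
  have fI: "L2_loc ?I f" "L2_loc ?I f'" "weak_deriv ?I 1 f f'"
    using f sub(1) L2_loc_subset weak_deriv_subset by blast+
  have gI: "L2_loc ?I (\<lambda>x. g (- x))" "L2_loc ?I (\<lambda>x. g' (- x))"
    "weak_deriv ?I 1 (\<lambda>x. g (- x)) (\<lambda>x. - g' (- x))"
    using L2_loc_subset[OF L2_loc_reflect sub(2)] weak_deriv_subset[OF weak_deriv_reflect sub(2)] g
    by blast+
  have gI': "L2_loc ?I (\<lambda>x. - g' (- x))"
    using L2_loc_linear[OF gI(2) gI(2), of "- 1" 0] by simp
  \<comment> \<open>Compares the weak derivatives of both sides of the initial condition
    \<open>f x + g (- x) = u0 x\<close>; reflection turns that of \<open>g (- x)\<close> into
    \<open>- g' (- x)\<close>.\<close>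
  have "AE x in lborel. x \<in> ?I \<longrightarrow> 1 * f' x + 1 * - g' (- x) = u0' x"
  proof (rule weak_deriv_unique_AE)
    show "weak_deriv ?I 1 (\<lambda>x. 1 * f x + 1 * g (- x)) (\<lambda>x. 1 * f' x + 1 * - g' (- x))"
      by (intro weak_deriv_linear fI gI gI') simp
    show "AE x in lborel. x \<in> ?I \<longrightarrow> 1 * f x + 1 * g (- x) = u0 x"
      using eq0 by eventually_elim auto
    show "L2_loc ?I (\<lambda>x. 1 * f x + 1 * g (- x))" "L2_loc ?I (\<lambda>x. 1 * f' x + 1 * - g' (- x))"
      by (intro L2_loc_linear fI gI gI')+
  qed (use u0' \<open>L2 ?I u0\<close> in \<open>auto intro: L2_imp_L2_loc\<close>)
  \<comment> \<open>Solves the linear system \<open>f' x - g' (- x) = u0' x\<close>,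
    \<open>f' x + g' (- x) = u1 x\<close>.\<close>
  then have eq: "AE x in lborel. x \<in> ?I \<longrightarrow> f' x = 1 / 2 * u1 x + 1 / 2 * u0' x \<and>
      g' (- x) = 1 / 2 * u1 x + - 1 / 2 * u0' x"
    using eq1 by eventually_elim (auto simp: u_t_def)
  show "L2 ?I f'"
    by (rule L2_cong_AE[OF L2_linear[OF u1 u0'(1), of "1 / 2" "1 / 2"]])
      (use eq fI in \<open>auto intro: L2_loc_imp_set_borel_measurable elim: eventually_mono\<close>)
  have "L2 ?I (\<lambda>x. g' (- x))"
    by (rule L2_cong_AE[OF L2_linear[OF u1 u0'(1), of "1 / 2" "- 1 / 2"]])
      (use eq gI in \<open>auto intro: L2_loc_imp_set_borel_measurable elim: eventually_mono\<close>)
  then show "L2 {-1<..<0} g'"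
    using L2_reflect_greaterThanLessThan[of 0 0 "-1" "\<lambda>x. g' (- x)"] by simp
qed

text \<open>Beyond the initial intervals (0,1) and (-1,0) there remains a compact subset of the open
  half-line, where the local bounds apply.\<close>

lemma weak_solution_L2:
  assumes "weak_solution k \<mu>1 \<mu>2 \<tau> u0 u1 g0 u f g f' g'"
  shows "L2 {0<..<R} f'" and "L2 {-1<..<R} g'"
proof -
  have loc: "L2_loc {0<..} f'" "L2_loc {-1<..} g'"
    using assms by (auto simp: weak_solution_def dAlembert_rep_def)
  have "L2 ({0<..<1} \<union> {1..R}) f'"
    by (intro L2_Un weak_solution_L2_initial[OF assms] L2_loc_imp_L2_atLeastAtMost[OF loc(1)]) auto
  then show "L2 {0<..<R} f'" by (rule L2_subset) auto
  have "L2 ({-1<..<0} \<union> {0..R}) g'"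
    by (intro L2_Un weak_solution_L2_initial[OF assms] L2_loc_imp_L2_atLeastAtMost[OF loc(2)]) auto
  then show "L2 {-1<..<R} g'" by (rule L2_subset) auto
qed

text \<open>By the condition at x = 0, \<open>f + g\<close> vanishes almost everywhere on the
  positive half-line, hence so does its weak derivative: waves are reflected there with a change of
  sign.\<close>

lemma weak_solution_reflection:
  assumes "weak_solution k \<mu>1 \<mu>2 \<tau> u0 u1 g0 u f g f' g'"
  shows "AE x in lborel. x > 0 \<longrightarrow> f' x = - g' x"
proof -
  let ?I = "{0::real<..}"
  have f: "L2_loc ?I f" "L2_loc ?I f'" "weak_deriv ?I 1 f f'"
    and g: "L2_loc {-1<..} g" "L2_loc {-1<..} g'" "weak_deriv {-1<..} 1 g g'"
    and eq: "AE t in lborel. t > 0 \<longrightarrow> f t + g t = 0"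
    using assms by (auto simp: weak_solution_def dAlembert_rep_def)
  have sub: "?I \<subseteq> {-1<..}" by auto
  have gI: "L2_loc ?I g" "L2_loc ?I g'" "weak_deriv ?I 1 g g'"
    using g sub L2_loc_subset weak_deriv_subset by blast+
  have zero: "L2_loc ?I (\<lambda>x. 0)" using L2_loc_linear[OF f(1) f(1), of 0 0] by simp
  have "AE x in lborel. x \<in> ?I \<longrightarrow> 1 * f' x + 1 * g' x = 0"
  proof (rule weak_deriv_unique_AE)
    show "weak_deriv ?I 1 (\<lambda>x. 1 * f x + 1 * g x) (\<lambda>x. 1 * f' x + 1 * g' x)"
      by (intro weak_deriv_linear f gI) simp
    show "AE x in lborel. x \<in> ?I \<longrightarrow> 1 * f x + 1 * g x = 0"
      using eq by eventually_elim auto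
    show "weak_deriv ?I 1 (\<lambda>x. 0) (\<lambda>x. 0)" by (simp add: weak_deriv_def)
    show "L2_loc ?I (\<lambda>x. 1 * f x + 1 * g x)" "L2_loc ?I (\<lambda>x. 1 * f' x + 1 * g' x)"
      by (intro L2_loc_linear f gI)+
  qed (auto intro: zero)
  then show ?thesis by eventually_elim auto
qed

text \<open>For negative times this is the history. For positive times the velocity is f' (1 + (1 +
  k) r) + g' (-1 + (1 - k) r), and 0 < k < 1 makes both arguments increase, so they stay where
  \<open>f'\<close> and \<open>g'\<close> are controlled.\<close>

lemma weak_solution_L2_bdry_vel:
  assumes "weak_solution k \<mu>1 \<mu>2 \<tau> u0 u1 g0 u f g f' g'" "0 < k" "k < 1"
  shows "L2 {-\<tau><..<R} (bdry_vel k g0 f' g')"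
proof -
  let ?v = "bdry_vel k g0 f' g'"
  have "L2 {-\<tau><..<0} ?v"
    by (rule L2_cong[of _ g0]) (use assms in \<open>auto simp: weak_solution_def bdry_vel_def\<close>)
  moreover have "L2 {0<..<R} ?v"
  proof (rule L2_cong)
    have "L2 {0<..<R} (\<lambda>r. f' (1 + (1 + k) * r))"
      by (rule L2_affine_greaterThanLessThan)
        (use assms in \<open>auto intro: L2_subset[OF weak_solution_L2(1)[OF assms(1)]]\<close>)
    moreover have "L2 {0<..<R} (\<lambda>r. g' (- 1 + (1 - k) * r))"
      by (rule L2_affine_greaterThanLessThan)
        (use assms in \<open>auto intro: L2_subset[OF weak_solution_L2(2)[OF assms(1)]]\<close>)
    ultimately show "L2 {0<..<R} (\<lambda>r. 1 * f' (1 + (1 + k) * r) + 1 * g' (- 1 + (1 - k) * r))"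
      by (rule L2_linear)
  qed (auto simp: bdry_vel_def u_t_def l_def algebra_simps)
  ultimately have "L2 ({-\<tau><..<0} \<union> ({0} \<union> {0<..<R})) ?v"
    by (intro L2_Un L2_singleton) auto
  then show ?thesis by (rule L2_subset) auto
qed

section \<open>The energy as a sum of integrals over moving windows\<close>

lemma L2_imp_set_integrable_square: "L2 S f \<Longrightarrow> set_integrable lborel S (\<lambda>x. (f x)\<^sup>2)"
  by (simp add: L2_def)

text \<open>Substitute r = t - \<tau> \<rho>. The resulting factor 1/\<tau> is the source of the
  adjustable constant in the quadratic form.\<close>

lemma delay_energy_eq:
  fixes v :: "real \<Rightarrow> real"
  assumes "\<tau> > 0"
  shows "(LINT \<rho>:{0<..<1}|lborel. (v (t - \<tau> * \<rho>))\<^sup>2) = 1 / \<tau> * (LINT r:{t - \<tau><..<t}|lborel. (v r)\<^sup>2)"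
proof -
  have "{\<rho>. t + - \<tau> * \<rho> \<in> {t - \<tau><..<t}} = {0<..<1}"
    using assms by (auto simp: zero_less_mult_iff)
  then show ?thesis
    using set_integral_affine[of "- \<tau>" "{t - \<tau><..<t}" "\<lambda>r. (v r)\<^sup>2" t] assms by simp
qed

text \<open>The mixed products of \<open>f'\<close> and \<open>g'\<close> cancel in the sum of
  squares; the two remaining parts become windows to the right and to the left of
  \<open>t\<close>.\<close>

lemma wave_energy_eq:
  assumes "L2 {t<..<t + b} f'" "L2 {t - b<..<t} g'"
  shows "1 / 2 * (LINT x:{0<..<b}|lborel. (u_t f' g' x t)\<^sup>2 + (u_x f' g' x t)\<^sup>2)
    = (LINT x:{t<..<t + b}|lborel. (f' x)\<^sup>2) + (LINT x:{t - b<..<t}|lborel. (g' x)\<^sup>2)"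
proof -
  have f: "L2 {0<..<b} (\<lambda>x. f' (t + x))"
    using L2_affine_greaterThanLessThan[of t 1 0 b f'] assms(1) by simp
  have g: "L2 {0<..<b} (\<lambda>x. g' (t - x))"
    using L2_reflect_greaterThanLessThan[of t b 0 g'] assms(2) by simp
  have "(u_t f' g' x t)\<^sup>2 + (u_x f' g' x t)\<^sup>2 = 2 * ((f' (t + x))\<^sup>2 + (g' (t - x))\<^sup>2)" for x
    by (simp add: u_t_def u_x_def power2_eq_square algebra_simps)
  then have "1 / 2 * (LINT x:{0<..<b}|lborel. (u_t f' g' x t)\<^sup>2 + (u_x f' g' x t)\<^sup>2)
    = (LINT x:{0<..<b}|lborel. (f' (t + x))\<^sup>2 + (g' (t - x))\<^sup>2)"
    by (simp only: set_integral_mult_right)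
  also have "\<dots> = (LINT x:{0<..<b}|lborel. (f' (t + x))\<^sup>2) + (LINT x:{0<..<b}|lborel. (g' (t - x))\<^sup>2)"
    by (intro set_integral_add L2_imp_set_integrable_square f g)
  also have "(LINT x:{0<..<b}|lborel. (f' (t + x))\<^sup>2) = (LINT x:{t<..<t + b}|lborel. (f' x)\<^sup>2)"
    using set_integral_affine_greaterThanLessThan[of 1 t 0 b "\<lambda>x. (f' x)\<^sup>2"] by simp
  also have "(LINT x:{0<..<b}|lborel. (g' (t - x))\<^sup>2) = (LINT x:{t - b<..<t}|lborel. (g' x)\<^sup>2)"
    using set_integral_reflect_greaterThanLessThan[of 0 b "\<lambda>x. (g' x)\<^sup>2" t] by simp
  finally show ?thesis .
qed

text \<open>All energy terms are integrals of fixed functions over moving intervals, so their increments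
  only involve the end points.\<close>

lemma E2_increment:
  assumes sol: "weak_solution k \<mu>1 \<mu>2 \<tau> u0 u1 g0 u f g f' g'"
    and k: "0 < k" "k < 1" and "\<tau> > 0" and st: "0 \<le> s" "s \<le> t"
  defines "v \<equiv> bdry_vel k g0 f' g'"
  shows "E2 k \<xi> \<tau> g0 f' g' t - E2 k \<xi> \<tau> g0 f' g' s =
    (LINT r:{s<..<t}|lborel. (1 + k) * (f' (r + l k r))\<^sup>2 - (1 - k) * (g' (r - l k r))\<^sup>2
      + \<xi> / (2 * \<tau>) * ((v r)\<^sup>2 - (v (r - \<tau>))\<^sup>2))"
proof -
  \<comment> \<open>These inequalities order the end points of the windows at the times
    \<open>s\<close> and \<open>t\<close>; by k < 1 even the left end \<open>t - l k t\<close> moves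
    to the right.\<close>
  have kst: "k * s \<le> k * t" "0 \<le> k * s" "k * s \<le> s" "k * t \<le> t"  "t - s \<ge> k * t - k * s"
    using k st mult_right_mono[of k 1 "t - s"] by (auto simp: mult_left_mono mult_left_le_one_le algebra_simps)
  have F: "L2 {a<..<b} f'" if "0 \<le> a" for a b
    using that by (intro L2_subset[OF weak_solution_L2(1)[OF sol, of b]]) auto
  have G: "L2 {a<..<b} g'" if "-1 \<le> a" for a b
    using that by (intro L2_subset[OF weak_solution_L2(2)[OF sol, of b]]) auto
  have V: "L2 {a<..<b} v" if "-\<tau> \<le> a" for a b
    unfolding v_def using that
    by (intro L2_subset[OF weak_solution_L2_bdry_vel[OF sol k, of b]]) auto
  note sq = L2_imp_set_integrable_square
  have E: "E2 k \<xi> \<tau> g0 f' g' t = (LINT x:{t<..<t + l k t}|lborel. (f' x)\<^sup>2)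
      + (LINT x:{t - l k t<..<t}|lborel. (g' x)\<^sup>2)
      + \<xi> / (2 * \<tau>) * (LINT r:{t - \<tau><..<t}|lborel. (v r)\<^sup>2)" if "t \<ge> 0" for t
  proof -
    have "k * t \<le> t" using k that by (simp add: mult_left_le_one_le)
    then have "L2 {t<..<t + l k t} f'" "L2 {t - l k t<..<t} g'"
      using that by (auto intro!: F G simp: l_def)
    from wave_energy_eq[OF this] show ?thesis
      using delay_energy_eq[OF \<open>\<tau> > 0\<close>, of v t] unfolding E2_def v_def by simp
  qed
  have int_f: "L2 {s<..<t} (\<lambda>r. f' (r + l k r))"
    using L2_affine_greaterThanLessThan[OF F, of 1 "1 + k" s t] k st by (simp add: l_def algebra_simps)
  have int_g: "L2 {s<..<t} (\<lambda>r. g' (r - l k r))"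
    using L2_affine_greaterThanLessThan[OF G, of "- 1" "1 - k" s t] k st kst by (simp add: l_def algebra_simps)
  have int_w: "L2 {s<..<t} (\<lambda>r. v (r - \<tau>))"
    using L2_affine_greaterThanLessThan[OF V, of "- \<tau>" 1 s t] st by simp
  have int_v: "L2 {s<..<t} v" using st \<open>\<tau> > 0\<close> by (intro V) auto
  \<comment> \<open>The outer ends \<open>t + l k t\<close> and \<open>t - l k t\<close> move with
    the speeds \<open>1 + k\<close> and \<open>1 - k\<close>, which become the factors of the flux
    through the moving boundary.\<close>
  have "(LINT x:{t<..<t + l k t}|lborel. (f' x)\<^sup>2) - (LINT x:{s<..<s + l k s}|lborel. (f' x)\<^sup>2)
      = (LINT x:{s + l k s<..<t + l k t}|lborel. (f' x)\<^sup>2) - (LINT x:{s<..<t}|lborel. (f' x)\<^sup>2)"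
    using st kst by (intro set_integral_moving_window sq F) (auto simp: l_def)
  moreover have "(LINT x:{s + l k s<..<t + l k t}|lborel. (f' x)\<^sup>2) = (1 + k) * (LINT r:{s<..<t}|lborel. (f' (r + l k r))\<^sup>2)"
    using set_integral_affine_greaterThanLessThan[of "1 + k" 1 s t "\<lambda>x. (f' x)\<^sup>2"] k
    by (simp add: l_def algebra_simps)
  moreover have "(LINT x:{t - l k t<..<t}|lborel. (g' x)\<^sup>2) - (LINT x:{s - l k s<..<s}|lborel. (g' x)\<^sup>2)
      = (LINT x:{s<..<t}|lborel. (g' x)\<^sup>2) - (LINT x:{s - l k s<..<t - l k t}|lborel. (g' x)\<^sup>2)"
    using st kst by (intro set_integral_moving_window sq G) (auto simp: l_def)
  moreover have "(LINT x:{s - l k s<..<t - l k t}|lborel. (g' x)\<^sup>2) = (1 - k) * (LINT r:{s<..<t}|lborel. (g' (r - l k r))\<^sup>2)"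
    using set_integral_affine_greaterThanLessThan[of "1 - k" "- 1" s t "\<lambda>x. (g' x)\<^sup>2"] k
    by (simp add: l_def algebra_simps)
  \<comment> \<open>The inner ends of both windows lie at \<open>t\<close>, that is at x = 0, and
    their contributions cancel by reflection.\<close>
  moreover have "(LINT x:{s<..<t}|lborel. (f' x)\<^sup>2) = (LINT x:{s<..<t}|lborel. (g' x)\<^sup>2)"
    unfolding set_lebesgue_integral_def
  proof (rule integral_cong_AE)
    show "AE x in lborel. indicator {s<..<t} x *\<^sub>R (f' x)\<^sup>2 = indicator {s<..<t} x *\<^sub>R (g' x)\<^sup>2"
      using weak_solution_reflection[OF sol] by eventually_elim (use st in \<open>auto simp: indicator_def\<close>)
  qed (use sq[OF F, of s t] sq[OF G, of s t] st in \<open>auto simp: set_integrable_def\<close>)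
  moreover have "\<xi> / (2 * \<tau>) * (LINT r:{t - \<tau><..<t}|lborel. (v r)\<^sup>2) - \<xi> / (2 * \<tau>) * (LINT r:{s - \<tau><..<s}|lborel. (v r)\<^sup>2)
      = \<xi> / (2 * \<tau>) * ((LINT r:{s<..<t}|lborel. (v r)\<^sup>2) - (LINT r:{s<..<t}|lborel. (v (r - \<tau>))\<^sup>2))"
  proof -
    have "(LINT r:{t - \<tau><..<t}|lborel. (v r)\<^sup>2) - (LINT r:{s - \<tau><..<s}|lborel. (v r)\<^sup>2)
        = (LINT r:{s<..<t}|lborel. (v r)\<^sup>2) - (LINT r:{s - \<tau><..<t - \<tau>}|lborel. (v r)\<^sup>2)"
      using st \<open>\<tau> > 0\<close> by (intro set_integral_moving_window sq V) auto
    also have "(LINT r:{s - \<tau><..<t - \<tau>}|lborel. (v r)\<^sup>2) = (LINT r:{s<..<t}|lborel. (v (r - \<tau>))\<^sup>2)"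
      using set_integral_affine_greaterThanLessThan[of 1 "- \<tau>" s t "\<lambda>x. (v x)\<^sup>2"] by simp
    finally show ?thesis by (metis right_diff_distrib)
  qed
  ultimately have "E2 k \<xi> \<tau> g0 f' g' t - E2 k \<xi> \<tau> g0 f' g' s =
      (1 + k) * (LINT r:{s<..<t}|lborel. (f' (r + l k r))\<^sup>2) - (1 - k) * (LINT r:{s<..<t}|lborel. (g' (r - l k r))\<^sup>2)
      + \<xi> / (2 * \<tau>) * ((LINT r:{s<..<t}|lborel. (v r)\<^sup>2) - (LINT r:{s<..<t}|lborel. (v (r - \<tau>))\<^sup>2))"
    using E[OF st(1)] E[OF order_trans[OF st]] by linarith
  also have "\<dots> = (LINT r:{s<..<t}|lborel. (1 + k) * (f' (r + l k r))\<^sup>2 - (1 - k) * (g' (r - l k r))\<^sup>2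
      + \<xi> / (2 * \<tau>) * ((v r)\<^sup>2 - (v (r - \<tau>))\<^sup>2))"
    by (simp only: set_integral_add set_integral_diff set_integral_mult_right set_integrable_mult_right
        sq[OF int_f] sq[OF int_g] sq[OF int_v] sq[OF int_w])
  finally show ?thesis .
qed

text \<open>Completes the square in \<open>k m - v\<close>, where \<open>m = \<mu>1 v + \<mu>2 w = b - a\<close>.\<close>

lemma boundary_flux_eq:
  fixes a b w k \<mu>1 \<mu>2 c :: real
  assumes "a - b = - \<mu>1 * (a + b) - \<mu>2 * w"
  shows "2 * k * ((1 + k) * a\<^sup>2 - (1 - k) * b\<^sup>2 + c * ((a + b)\<^sup>2 - w\<^sup>2))
    = ((k * \<mu>1 - 1) * (a + b) + k * \<mu>2 * w)\<^sup>2 - (1 - k\<^sup>2) * (a + b)\<^sup>2 + 2 * k * c * ((a + b)\<^sup>2 - w\<^sup>2)"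
proof -
  have "(k * \<mu>1 - 1) * (a + b) + k * \<mu>2 * w = k * (\<mu>1 * (a + b) + \<mu>2 * w) - (a + b)"
    by (simp add: algebra_simps)
  also have "\<mu>1 * (a + b) + \<mu>2 * w = b - a" using assms by linarith
  finally show ?thesis by (simp only:) (simp add: power2_eq_square algebra_simps)
qed

text \<open>With q = S - |p| one has |p| + q = S and |n| \<le> q. The weighted Cauchy-Schwarz
  inequality bounds the square by S (|p| v^2 + q w^2), which is exactly S^2 v^2 - S q (v^2 - w^2);
  this dictates the weight S q.\<close>

lemma flux_form_nonpos:
  fixes p n S v w :: real
  assumes "\<bar>n\<bar> \<le> S - \<bar>p\<bar>"
  shows "(p * v + n * w)\<^sup>2 - S\<^sup>2 * v\<^sup>2 + S * (S - \<bar>p\<bar>) * (v\<^sup>2 - w\<^sup>2) \<le> 0"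
proof -
  define q where "q = S - \<bar>p\<bar>"
  have "\<bar>p * v + n * w\<bar> \<le> \<bar>p\<bar> * \<bar>v\<bar> + \<bar>n\<bar> * \<bar>w\<bar>"
    by (metis abs_mult abs_triangle_ineq)
  also have "\<dots> \<le> \<bar>p\<bar> * \<bar>v\<bar> + q * \<bar>w\<bar>" using assms by (simp add: q_def mult_right_mono)
  finally have "(p * v + n * w)\<^sup>2 \<le> (\<bar>p\<bar> * \<bar>v\<bar> + q * \<bar>w\<bar>)\<^sup>2"
    by (metis abs_ge_zero power2_abs power_mono)
  \<comment> \<open>Lagrange's identity: the subtracted term is the defect in the Cauchy-Schwarz
    inequality.\<close>
  also have "\<dots> = (\<bar>p\<bar> + q) * (\<bar>p\<bar> * v\<^sup>2 + q * w\<^sup>2) - \<bar>p\<bar> * q * (\<bar>v\<bar> - \<bar>w\<bar>)\<^sup>2"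
  proof -
    have "v\<^sup>2 = \<bar>v\<bar>\<^sup>2" "w\<^sup>2 = \<bar>w\<bar>\<^sup>2" by simp_all
    then show ?thesis by (simp only:) (simp add: power2_eq_square algebra_simps)
  qed
  also have "\<dots> \<le> (\<bar>p\<bar> + q) * (\<bar>p\<bar> * v\<^sup>2 + q * w\<^sup>2)" using assms by (simp add: q_def)
  also have "\<dots> = S\<^sup>2 * v\<^sup>2 - S * (S - \<bar>p\<bar>) * (v\<^sup>2 - w\<^sup>2)"
    by (simp add: q_def power2_eq_square algebra_simps)
  finally show ?thesis by simp
qed

text \<open>With d = n - S the form is (p^2 + S d) v^2 + 2 p n v w + n d w^2. Multiplication by d
  completes the square to n (d w + p v)^2 + S (d^2 - p^2) v^2, where |p| \<le> d.\<close>

lemma flux_form_nonneg: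
  fixes p n S v w :: real
  assumes "\<bar>p\<bar> + S \<le> n" "S > 0"
  shows "(p * v + n * w)\<^sup>2 - S\<^sup>2 * v\<^sup>2 + S * n * (v\<^sup>2 - w\<^sup>2) \<ge> 0" (is "?F \<ge> 0")
proof -
  define d where "d = n - S"
  have n: "n = S + d" by (simp add: d_def)
  have "\<bar>p\<bar> \<le> d" using assms by (simp add: d_def)
  show ?thesis
  proof (cases "d = 0")
    \<comment> \<open>Here p = 0 and n = S, and the form vanishes identically.\<close>
    case True
    then show ?thesis using \<open>\<bar>p\<bar> \<le> d\<close> n by (simp add: power2_eq_square algebra_simps)
  next
    case False
    then have "d > 0" using \<open>\<bar>p\<bar> \<le> d\<close> by linarith
    have "p\<^sup>2 \<le> d\<^sup>2" using \<open>\<bar>p\<bar> \<le> d\<close> abs_le_square_iff[of p d] by simp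
    then have "0 \<le> n * (d * w + p * v)\<^sup>2 + S * (d\<^sup>2 - p\<^sup>2) * v\<^sup>2"
      using assms \<open>\<bar>p\<bar> \<le> d\<close> by (intro add_nonneg_nonneg mult_nonneg_nonneg) auto
    also have "\<dots> = d * ?F" by (simp add: n power2_eq_square algebra_simps)
    finally show ?thesis using \<open>d > 0\<close> by (simp add: zero_le_mult_iff)
  qed
qed

text \<open>The velocities are hidden behind an existential quantifier, because both halves of the
  theorem use only the sign of the form at arbitrary reals. The factor \<open>2 * k\<close> turns
  the weight \<open>\<xi> / (2 * \<tau>)\<close> into \<open>k * \<xi> / \<tau>\<close>.\<close>

lemma E2_increment_AE:
  assumes sol: "weak_solution k \<mu>1 \<mu>2 \<tau> u0 u1 g0 u f g f' g'"
    and k: "0 < k" "k < 1" and "\<tau> > 0" and st: "0 \<le> s" "s \<le> t"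
  shows "\<exists>h. E2 k \<xi> \<tau> g0 f' g' t - E2 k \<xi> \<tau> g0 f' g' s = (LINT r:{s<..<t}|lborel. h r) \<and>
    (AE r in lborel. r \<in> {s<..<t} \<longrightarrow> (\<exists>v w. 2 * k * h r =
      ((k * \<mu>1 - 1) * v + k * \<mu>2 * w)\<^sup>2 - (1 - k\<^sup>2) * v\<^sup>2 + k * \<xi> / \<tau> * (v\<^sup>2 - w\<^sup>2)))"
proof (intro exI conjI)
  let ?v = "bdry_vel k g0 f' g'"
  let ?h = "\<lambda>r. (1 + k) * (f' (r + l k r))\<^sup>2 - (1 - k) * (g' (r - l k r))\<^sup>2
      + \<xi> / (2 * \<tau>) * ((?v r)\<^sup>2 - (?v (r - \<tau>))\<^sup>2)"
  show "E2 k \<xi> \<tau> g0 f' g' t - E2 k \<xi> \<tau> g0 f' g' s = (LINT r:{s<..<t}|lborel. ?h r)"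
    by (rule E2_increment) fact+
  have "AE r in lborel. r > 0 \<longrightarrow> u_x f' g' (l k r) r = - \<mu>1 * ?v r - \<mu>2 * ?v (r - \<tau>)"
    using sol by (simp add: weak_solution_def)
  then show "AE r in lborel. r \<in> {s<..<t} \<longrightarrow> (\<exists>v w. 2 * k * ?h r =
      ((k * \<mu>1 - 1) * v + k * \<mu>2 * w)\<^sup>2 - (1 - k\<^sup>2) * v\<^sup>2 + k * \<xi> / \<tau> * (v\<^sup>2 - w\<^sup>2))"
  proof eventually_elim
    case (elim r)
    show ?case
    proof (intro impI exI)
      assume "r \<in> {s<..<t}"
      then have "r > 0" using st by simp
      then have v: "?v r = f' (r + l k r) + g' (r - l k r)"
        by (simp add: bdry_vel_def u_t_def)
      show "2 * k * ?h r = ((k * \<mu>1 - 1) * ?v r + k * \<mu>2 * ?v (r - \<tau>))\<^sup>2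
          - (1 - k\<^sup>2) * (?v r)\<^sup>2 + k * \<xi> / \<tau> * ((?v r)\<^sup>2 - (?v (r - \<tau>))\<^sup>2)"
        using boundary_flux_eq[of "f' (r + l k r)" "g' (r - l k r)" \<mu>1 \<mu>2 "?v (r - \<tau>)" k "\<xi> / (2 * \<tau>)"]
          elim \<open>r > 0\<close> unfolding v u_x_def by simp
    qed
  qed
qed

theorem theorem1p3:
  fixes k \<mu>1 \<mu>2 \<xi> :: real
  assumes "0 < k" and "k < 1" and "\<xi> > 0"
  shows "((1 - sqrt (1 - k\<^sup>2)) / k < \<mu>1 \<and> \<mu>1 < (1 + sqrt (1 - k\<^sup>2)) / k \<and>
          \<bar>\<mu>2\<bar> < (- \<bar>k * \<mu>1 - 1\<bar> + sqrt (1 - k\<^sup>2)) / k \<longrightarrow>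
          (\<exists>\<tau>>0. \<forall>u0 u1 g0 u f g f' g'. weak_solution k \<mu>1 \<mu>2 \<tau> u0 u1 g0 u f g f' g' \<longrightarrow>
             antimono_on {0..} (E2 k \<xi> \<tau> g0 f' g')))
       \<and> (\<mu>2 \<ge> (\<bar>k * \<mu>1 - 1\<bar> + sqrt (1 - k\<^sup>2)) / k \<longrightarrow>
          (\<exists>\<tau>>0. \<forall>u0 u1 g0 u f g f' g'. weak_solution k \<mu>1 \<mu>2 \<tau> u0 u1 g0 u f g f' g' \<longrightarrow>
             mono_on {0..} (E2 k \<xi> \<tau> g0 f' g')))"
proof -
  define S where "S = sqrt (1 - k\<^sup>2)"
  define p where "p = k * \<mu>1 - 1"
  define n where "n = k * \<mu>2"
  have "k\<^sup>2 < 1" using assms by (simp add: abs_square_less_1)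
  then have S: "S > 0" "1 - k\<^sup>2 = S\<^sup>2" by (auto simp: S_def)
  show ?thesis
    unfolding S_def[symmetric] p_def[symmetric]
  proof (intro conjI impI)
    assume "(1 - S) / k < \<mu>1 \<and> \<mu>1 < (1 + S) / k \<and> \<bar>\<mu>2\<bar> < (- \<bar>p\<bar> + S) / k"
    then have "\<bar>n\<bar> < S - \<bar>p\<bar>"
      using \<open>0 < k\<close> by (simp add: n_def abs_mult pos_less_divide_eq mult.commute)
    then have "S - \<bar>p\<bar> > 0" by linarith
    \<comment> \<open>Solves \<open>k * \<xi> / \<tau> = S * (S - \<bar>p\<bar>)\<close>, the weight
      that \<open>flux_form_nonpos\<close> requires.\<close>
    define \<tau> where "\<tau> = k * \<xi> / (S * (S - \<bar>p\<bar>))"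
    have "\<tau> > 0" using assms S \<open>S - \<bar>p\<bar> > 0\<close> by (simp add: \<tau>_def)
    have \<tau>: "k * \<xi> / \<tau> = S * (S - \<bar>p\<bar>)" using assms by (simp add: \<tau>_def)
    have "E2 k \<xi> \<tau> g0 f' g' t \<le> E2 k \<xi> \<tau> g0 f' g' s"
      if sol: "weak_solution k \<mu>1 \<mu>2 \<tau> u0 u1 g0 u f g f' g'" and st: "0 \<le> s" "s \<le> t"
      for u0 u1 g0 u f g f' g' s t
    proof -
      obtain h where h: "E2 k \<xi> \<tau> g0 f' g' t - E2 k \<xi> \<tau> g0 f' g' s = (LINT r:{s<..<t}|lborel. h r)"
        "AE r in lborel. r \<in> {s<..<t} \<longrightarrow> (\<exists>v w. 2 * k * h r =
          (p * v + n * w)\<^sup>2 - S\<^sup>2 * v\<^sup>2 + S * (S - \<bar>p\<bar>) * (v\<^sup>2 - w\<^sup>2))"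
        using E2_increment_AE[OF sol assms(1,2) \<open>\<tau> > 0\<close> st, of \<xi>]
        unfolding \<tau> S(2) p_def[symmetric] n_def[symmetric] by blast
      have "AE r in lborel. r \<in> {s<..<t} \<longrightarrow> 2 * k * h r \<le> 0"
        using h(2) by eventually_elim (metis flux_form_nonpos \<open>\<bar>n\<bar> < S - \<bar>p\<bar>\<close> less_imp_le)
      \<comment> \<open>Negated and extended by zero, the integrand has the sign that
        \<open>integral_nonneg_AE\<close> expects on the whole line.\<close>
      then have "AE r in lborel. 0 \<le> - (indicator {s<..<t} r * h r)"
        by eventually_elim (use \<open>0 < k\<close> in \<open>auto simp: indicator_def mult_le_0_iff\<close>)
      then have "0 \<le> (LINT r|lborel. - (indicator {s<..<t} r * h r))"
        by (rule integral_nonneg_AE)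
      then show ?thesis using h(1) by (simp add: set_lebesgue_integral_def)
    qed
    then show "\<exists>\<tau>>0. \<forall>u0 u1 g0 u f g f' g'. weak_solution k \<mu>1 \<mu>2 \<tau> u0 u1 g0 u f g f' g' \<longrightarrow>
        antimono_on {0..} (E2 k \<xi> \<tau> g0 f' g')"
      using \<open>\<tau> > 0\<close> by (intro exI[of _ \<tau>]) (simp add: monotone_on_def)
  next
    assume "(\<bar>p\<bar> + S) / k \<le> \<mu>2"
    then have n: "\<bar>p\<bar> + S \<le> n"
      using \<open>0 < k\<close> by (simp add: n_def pos_divide_le_eq mult.commute)
    then have "n > 0" using S by linarith
    \<comment> \<open>Solves \<open>k * \<xi> / \<tau> = S * n\<close>, the weight that
      \<open>flux_form_nonneg\<close> requires.\<close>
    define \<tau> where "\<tau> = k * \<xi> / (S * n)"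
    have "\<tau> > 0" using assms S \<open>n > 0\<close> by (simp add: \<tau>_def)
    have \<tau>: "k * \<xi> / \<tau> = S * n" using assms by (simp add: \<tau>_def)
    have "E2 k \<xi> \<tau> g0 f' g' s \<le> E2 k \<xi> \<tau> g0 f' g' t"
      if sol: "weak_solution k \<mu>1 \<mu>2 \<tau> u0 u1 g0 u f g f' g'" and st: "0 \<le> s" "s \<le> t"
      for u0 u1 g0 u f g f' g' s t
    proof -
      obtain h where h: "E2 k \<xi> \<tau> g0 f' g' t - E2 k \<xi> \<tau> g0 f' g' s = (LINT r:{s<..<t}|lborel. h r)"
        "AE r in lborel. r \<in> {s<..<t} \<longrightarrow> (\<exists>v w. 2 * k * h r =
          (p * v + n * w)\<^sup>2 - S\<^sup>2 * v\<^sup>2 + S * n * (v\<^sup>2 - w\<^sup>2))"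
        using E2_increment_AE[OF sol assms(1,2) \<open>\<tau> > 0\<close> st, of \<xi>]
        unfolding \<tau> S(2) p_def[symmetric] n_def[symmetric] by blast
      have "AE r in lborel. r \<in> {s<..<t} \<longrightarrow> 2 * k * h r \<ge> 0"
        using h(2) by eventually_elim (metis flux_form_nonneg n S(1))
      then have "AE r in lborel. 0 \<le> indicator {s<..<t} r * h r"
        by eventually_elim (use \<open>0 < k\<close> in \<open>auto simp: indicator_def zero_le_mult_iff\<close>)
      then have "0 \<le> (LINT r|lborel. indicator {s<..<t} r * h r)"
        by (rule integral_nonneg_AE)
      then show ?thesis using h(1) by (simp add: set_lebesgue_integral_def)
    qed
    then show "\<exists>\<tau>>0. \<forall>u0 u1 g0 u f g f' g'. weak_solution k \<mu>1 \<mu>2 \<tau> u0 u1 g0 u f g f' g' \<longrightarrow>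
        mono_on {0..} (E2 k \<xi> \<tau> g0 f' g')"
      using \<open>\<tau> > 0\<close> by (intro exI[of _ \<tau>]) (simp add: monotone_on_def)
  qed
qed

end
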